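(* Assume that $X_1,\dots,X_m$ satisfy the Hörmander condition on $\Omega$ and that $X_1(x),\dots,X_m(x)$ are linearly independent for every $x\in\Omega$. Let $u\in C^1_X(\Omega)$ and $x\in\Omega$. Then $u$ is $X$-differentiable at $x$, and the linear map $$d_Xu(x)(z)=\langle Xu(x)\cdot\tilde C(x),z\rangle,\qquad z\in\mathbb{R}^n,$$ is an $X$-differential of $u$ at $x$, where $\tilde C(x)=(C(x)\cdot C(x)^T)^{-1}\cdot C(x)$.
   Context: Let $m\le n$ be positive integers, $\Omega\subset\mathbb{R}^n$ a bounded domain, $X=(X_1,\dots,X_m)$ with $X_j=\sum_{i=1}^n c_{j,i}\,\partial/\partial x_i$ smooth vector fields on $\Omega$, and $C(x)=[c_{j,i}(x)]$ the $m\times n$ coefficient matrix (row $j$, column $i$). Hörmander condition on $\Omega$: $\dim\operatorname{Lie}(X_1,\dots,X_m)(x)=n$ for every $x\in\Omega$. For $u\in L^1_{loc}(\Omega)$, $Xu=(X_1u,\dots,X_mu)$ is the distributional horizontal gradient: $\langle Xu,\varphi\rangle=-\int_\Omega u\operatorname{div}(\varphi\cdot C(x))\,dx$ for $\varphi\in C_c^\infty(\Omega,\mathbb{R}^m)$; gradients are row vectors. $C^1_X(\Omega)=\{u\in C(\Omega): X_ju\in C(\Omega),\ j=1,\dots,m\}$. An absolutely continuous $\gamma:[0,T]\to\Omega$ is sub-unit if $\dot\gamma(t)=\sum_j a_j(t)X_j(\gamma(t))$ for a.e. $t$, with $a_j$ measurable and $\sum_ja_j^2\le1$ a.e.; $d_\Omega(x,y)$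 is the infimum of $T$ such that there is a sub-unit curve $\gamma:[0,T]\to\Omega$ with $\gamma(0)=x$, $\gamma(T)=y$. $u\in C(\Omega)$ is $X$-differentiable at $x\in\Omega$ if there is a linear map $L_x:\mathbb{R}^n\to\mathbb{R}$ with $$\lim_{d_\Omega(x,y)\to0}\frac{u(y)-u(x)-L_x(y-x)}{d_\Omega(x,y)}=0;$$ any such $L_x$ is called an $X$-differential of $u$ at $x$ and written $d_Xu(x)$ (it need not be unique). *)

theory Defs
  imports "HOL-Analysis.Analysis"
begin

text \<open>
  A family of vector fields is \<open>X :: 'm \<Rightarrow> real^'n \<Rightarrow> real^'n\<close>. Vector fields and functions on a
  domain \<open>\<Omega>\<close> are total functions whose values outside \<open>\<Omega>\<close> are never used. All derivatives are
  only taken at points of open sets.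
\<close>

fun Ck_on :: "nat \<Rightarrow> 'a::real_normed_vector set \<Rightarrow> ('a \<Rightarrow> 'b::real_normed_vector) \<Rightarrow> bool" where
  "Ck_on 0 S f \<longleftrightarrow> continuous_on S f"
| "Ck_on (Suc k) S f \<longleftrightarrow>
     (\<forall>x\<in>S. f differentiable (at x)) \<and> (\<forall>v. Ck_on k S (\<lambda>x. frechet_derivative f (at x) v))"

definition smooth_on :: "'a::real_normed_vector set \<Rightarrow> ('a \<Rightarrow> 'b::real_normed_vector) \<Rightarrow> bool" where
  "smooth_on S f \<longleftrightarrow> (\<forall>k. Ck_on k S f)"

definition bounded_domain :: "(real^'n::finite) set \<Rightarrow> bool" where
  "bounded_domain \<Omega> \<longleftrightarrow> \<Omega> \<noteq> {} \<and> open \<Omega> \<and> connected \<Omega> \<and> bounded \<Omega>"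

definition coeff_matrix :: "('m::finite \<Rightarrow> real^'n::finite \<Rightarrow> real^'n) \<Rightarrow> real^'n \<Rightarrow> real^'n^'m" where
  "coeff_matrix X x = (\<chi> j i. X j x $ i)"

definition lie_bracket ::
    "(real^'n::finite \<Rightarrow> real^'n) \<Rightarrow> (real^'n \<Rightarrow> real^'n) \<Rightarrow> real^'n \<Rightarrow> real^'n" where
  "lie_bracket V W x = frechet_derivative W (at x) (V x) - frechet_derivative V (at x) (W x)"

inductive_set lie_algebra :: "('m::finite \<Rightarrow> real^'n::finite \<Rightarrow> real^'n) \<Rightarrow> (real^'n \<Rightarrow> real^'n) set"
  for X where
  generator: "X j \<in> lie_algebra X"
| add: "V \<in> lie_algebra X \<Longrightarrow> W \<in> lie_algebra X \<Longrightarrow> (\<lambda>x. V x + W x) \<in> lie_algebra X"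
| scale: "V \<in> lie_algebra X \<Longrightarrow> (\<lambda>x. c *\<^sub>R V x) \<in> lie_algebra X"
| bracket: "V \<in> lie_algebra X \<Longrightarrow> W \<in> lie_algebra X \<Longrightarrow> lie_bracket V W \<in> lie_algebra X"

definition hoermander :: "(real^'n::finite) set \<Rightarrow> ('m::finite \<Rightarrow> real^'n \<Rightarrow> real^'n) \<Rightarrow> bool" where
  "hoermander \<Omega> X \<longleftrightarrow> (\<forall>x\<in>\<Omega>. dim {V x |V. V \<in> lie_algebra X} = CARD('n))"

text \<open>Independence as a family: injectivity excludes repeated vectors.\<close>

definition independent_at :: "('m::finite \<Rightarrow> real^'n::finite \<Rightarrow> real^'n) \<Rightarrow> real^'n \<Rightarrow> bool" where
  "independent_at X x \<longleftrightarrow> inj (\<lambda>j. X j x) \<and> independent (range (\<lambda>j. X j x))"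

definition test_functions :: "(real^'n::finite) set \<Rightarrow> (real^'n \<Rightarrow> real^'m::finite) set" where
  "test_functions \<Omega> =
     {\<phi>. smooth_on UNIV \<phi> \<and> compact (closure {x. \<phi> x \<noteq> 0}) \<and> closure {x. \<phi> x \<noteq> 0} \<subseteq> \<Omega>}"

definition divergence :: "(real^'n::finite \<Rightarrow> real^'n) \<Rightarrow> real^'n \<Rightarrow> real" where
  "divergence F x = (\<Sum>i\<in>UNIV. frechet_derivative (\<lambda>y. F y $ i) (at x) (axis i 1))"

definition distr_hgrad :: "(real^'n::finite) set \<Rightarrow> ('m::finite \<Rightarrow> real^'n \<Rightarrow> real^'n) \<Rightarrow>
    (real^'n \<Rightarrow> real) \<Rightarrow> (real^'n \<Rightarrow> real^'m) \<Rightarrow> real" where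
  "distr_hgrad \<Omega> X u \<phi> =
     - (LINT x:\<Omega>|lebesgue. u x * divergence (\<lambda>y. \<phi> y v* coeff_matrix X y) x)"

text \<open>
  The distribution \<open>Xu\<close> is the continuous function \<open>g\<close> on \<open>\<Omega>\<close>. Such a \<open>g\<close> is unique on an open
  \<open>\<Omega>\<close>, so it gives \<open>Xu\<close> its pointwise values.
\<close>

definition continuous_hgrad :: "(real^'n::finite) set \<Rightarrow> ('m::finite \<Rightarrow> real^'n \<Rightarrow> real^'n) \<Rightarrow>
    (real^'n \<Rightarrow> real) \<Rightarrow> (real^'n \<Rightarrow> real^'m) \<Rightarrow> bool" where
  "continuous_hgrad \<Omega> X u g \<longleftrightarrow> continuous_on \<Omega> g \<and>
     (\<forall>\<phi>\<in>test_functions \<Omega>. distr_hgrad \<Omega> X u \<phi> = (LINT x:\<Omega>|lebesgue. g x \<bullet> \<phi> x))"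

definition C1X :: "(real^'n::finite) set \<Rightarrow> ('m::finite \<Rightarrow> real^'n \<Rightarrow> real^'n) \<Rightarrow>
    (real^'n \<Rightarrow> real) set" where
  "C1X \<Omega> X = {u. continuous_on \<Omega> u \<and> (\<exists>g. continuous_hgrad \<Omega> X u g)}"

text \<open>The intervals \<open>k\<close> of a division are compact, nonempty and have disjoint interiors.\<close>

definition absolutely_continuous_on :: "real \<Rightarrow> real \<Rightarrow> (real \<Rightarrow> 'a::real_normed_vector) \<Rightarrow> bool" where
  "absolutely_continuous_on a b \<gamma> \<longleftrightarrow>
     (\<forall>\<epsilon>>0. \<exists>\<delta>>0. \<forall>D S. D division_of S \<and> S \<subseteq> {a..b} \<and> (\<Sum>k\<in>D. Sup k - Inf k) < \<delta> \<longrightarrow>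
        (\<Sum>k\<in>D. norm (\<gamma> (Sup k) - \<gamma> (Inf k))) < \<epsilon>)"

definition subunit_curve :: "(real^'n::finite) set \<Rightarrow> ('m::finite \<Rightarrow> real^'n \<Rightarrow> real^'n) \<Rightarrow>
    real \<Rightarrow> (real \<Rightarrow> real^'n) \<Rightarrow> bool" where
  "subunit_curve \<Omega> X T \<gamma> \<longleftrightarrow> absolutely_continuous_on 0 T \<gamma> \<and> \<gamma> ` {0..T} \<subseteq> \<Omega> \<and>
     (\<exists>a :: real \<Rightarrow> real^'m. a \<in> borel_measurable (lebesgue_on {0..T}) \<and>
        (AE t in lebesgue_on {0..T}.
           (\<Sum>j\<in>UNIV. (a t $ j)\<^sup>2) \<le> 1 \<and>
           (\<gamma> has_vector_derivative (\<Sum>j\<in>UNIV. a t $ j *\<^sub>R X j (\<gamma> t))) (at t within {0..T})))"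

text \<open>The value is \<open>\<infinity>\<close> if no sub-unit curve joins the two points.\<close>

definition cc_dist :: "(real^'n::finite) set \<Rightarrow> ('m::finite \<Rightarrow> real^'n \<Rightarrow> real^'n) \<Rightarrow>
    real^'n \<Rightarrow> real^'n \<Rightarrow> ennreal" where
  "cc_dist \<Omega> X x y =
     Inf {ennreal T |T. T \<ge> 0 \<and> (\<exists>\<gamma>. subunit_curve \<Omega> X T \<gamma> \<and> \<gamma> 0 = x \<and> \<gamma> T = y)}"

text \<open>The filter describes \<open>y \<in> \<Omega>\<close> with \<open>0 < d(x,y)\<close> and \<open>d(x,y) \<rightarrow> 0\<close>.\<close>

definition X_differential :: "(real^'n::finite) set \<Rightarrow> ('m::finite \<Rightarrow> real^'n \<Rightarrow> real^'n) \<Rightarrow>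
    (real^'n \<Rightarrow> real) \<Rightarrow> real^'n \<Rightarrow> (real^'n \<Rightarrow> real) \<Rightarrow> bool" where
  "X_differential \<Omega> X u x L \<longleftrightarrow> linear L \<and>
     ((\<lambda>y. (u y - u x - L (y - x)) / enn2real (cc_dist \<Omega> X x y)) \<longlongrightarrow> 0)
       (inf (filtercomap (cc_dist \<Omega> X x) (at_right 0)) (principal \<Omega>))"

definition X_differentiable :: "(real^'n::finite) set \<Rightarrow> ('m::finite \<Rightarrow> real^'n \<Rightarrow> real^'n) \<Rightarrow>
    (real^'n \<Rightarrow> real) \<Rightarrow> real^'n \<Rightarrow> bool" where
  "X_differentiable \<Omega> X u x \<longleftrightarrow> continuous_on \<Omega> u \<and> x \<in> \<Omega> \<and> (\<exists>L. X_differential \<Omega> X u x L)"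

definition C_tilde :: "('m::finite \<Rightarrow> real^'n::finite \<Rightarrow> real^'n) \<Rightarrow> real^'n \<Rightarrow> real^'n^'m" where
  "C_tilde X x = matrix_inv (coeff_matrix X x ** transpose (coeff_matrix X x)) ** coeff_matrix X x"

end

theory Submission
  imports Defs
begin

text \<open>
  Write \<open>g = Xu\<close> and \<open>q = Xu(x) C_tilde(x)\<close>. Since \<open>C_tilde(x) C(x)\<^sup>T\<close> is the identity,
  \<open>q \<bullet> X_j(x) = g_j(x)\<close> for every \<open>j\<close> (\<open>C_tilde_inner_field\<close>): the map \<open>z \<mapsto> q \<bullet> z\<close> has the same horizontal derivatives at
  \<open>x\<close> as \<open>u\<close>. If \<open>u\<close> were continuously differentiable, integrating along a sub-unit curve \<open>\<gamma>\<close> of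
  duration \<open>T\<close> from \<open>x\<close> to \<open>y\<close> with controls \<open>a_j\<close> would give

  \<open>u(y) - u(x) - q \<bullet> (y - x) = \<integral> \<Sum> a_j (g_j - q \<bullet> X_j)(\<gamma>(t)) dt\<close>,

  where the integrand is uniformly small for small \<open>T\<close>, because short sub-unit curves stay near
  \<open>x\<close> (\<open>subunit_curve_stays_in_cball\<close>) and \<open>g_j - q \<bullet> X_j\<close> is continuous and vanishes at \<open>x\<close>. Hence
  the left-hand side is \<open>o(T)\<close>, and taking the infimum over \<open>T\<close> turns this into \<open>o(d(x, y))\<close>.

  A function in \<open>C\<^sup>1\<^sub>X\<close> need not be differentiable, so \<open>u\<close> is first mollified. By Friedrichs'
  commutator argument (\<open>friedrichs_approximation\<close>) there are continuously differentiable \<open>U\<close> with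
  \<open>U\<close> uniformly close to \<open>u\<close> and each \<open>X_j U\<close> uniformly close to \<open>g_j\<close> on a given compact set; the
  estimate for \<open>U\<close> passes to the limit. The
  divergence theorem for compactly supported fields does the work twice. With \<open>k\<close> the mollifier
  centred at \<open>z\<close>, it rewrites the commutator of \<open>c \<bullet> \<nabla>\<close> with mollification as the integral of
  \<open>(u(y) - u(z)) div ((c(y) - c(z)) k(y))\<close>. And it shows that the first moment of the gradient of
  a radially decreasing bump is the dimension times the integral of the bump
  (\<open>integral_bump_grad_moment\<close>), so the last factor is bounded however small the support of \<open>k\<close>,
  while the first one tends to zero.

  The curves are only absolutely continuous. That such a curve with almost everywhere bounded
  derivative has correspondingly bounded increments is proved with a gauge
  (\<open>absolutely_continuous_norm_increment_le\<close>).
\<close>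

section \<open>Calculus of \<open>C\<^sup>k\<close> functions\<close>

lemma Ck_on_imp_continuous_on: "Ck_on k S f \<Longrightarrow> continuous_on S f"
  by (cases k) (auto intro!: continuous_at_imp_continuous_on differentiable_imp_continuous_within)

lemma Ck_on_SucD: "Ck_on (Suc k) S f \<Longrightarrow> Ck_on k S f"
proof (induction k arbitrary: f)
  case 0
  then show ?case using Ck_on_imp_continuous_on by fastforce
next
  case (Suc k)
  then show ?case by (metis Ck_on.simps(2))
qed

text \<open>
  Derivatives at points of an open set depend only on the values on that set.
\<close>

lemma Ck_on_cong:
  assumes "open S" "\<And>x. x \<in> S \<Longrightarrow> f x = g x" "Ck_on k S f"
  shows "Ck_on k S g"
  using assms(2,3)
proof (induction k arbitrary: f g)
  case 0
  then show ?case using continuous_on_cong by auto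
next
  case (Suc k)
  have d: "(g has_derivative f') (at x)" if "x \<in> S" "(f has_derivative f') (at x)" for x f'
    using that Suc.prems(1) assms(1) has_derivative_transform_within_open by blast
  have "g differentiable (at x)" if "x \<in> S" for x
    using Suc.prems(2) d that unfolding differentiable_def by (meson Ck_on.simps(2) differentiable_def)
  moreover have "frechet_derivative f (at x) = frechet_derivative g (at x)" if "x \<in> S" for x
    using Suc.prems(2) d that by (metis Ck_on.simps(2) frechet_derivative_at frechet_derivative_works)
  then have "Ck_on k S (\<lambda>x. frechet_derivative g (at x) v)" for v
    using Suc.IH[of "\<lambda>x. frechet_derivative f (at x) v"] Suc.prems(2) by simp
  ultimately show ?case by simp
qed

text \<open>
  Smoothness proofs go by induction over a class of functions that is closed under taking
  directional derivatives; this is the induction step, with the derivative given explicitly.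
\<close>

lemma Ck_on_SucI:
  assumes "open S" "\<And>x. x \<in> S \<Longrightarrow> (f has_derivative f' x) (at x)"
    and "\<And>v. Ck_on k S (\<lambda>x. f' x v)"
  shows "Ck_on (Suc k) S f"
proof -
  have "frechet_derivative f (at x) = f' x" if "x \<in> S" for x
    using assms(2) that frechet_derivative_at by metis
  then have "Ck_on k S (\<lambda>x. frechet_derivative f (at x) v)" for v
    using Ck_on_cong[OF assms(1) _ assms(3)[of v]] by simp
  then show ?thesis using assms(2) by (auto simp: differentiable_def)
qed

lemma Ck_on_const: "open S \<Longrightarrow> Ck_on k S (\<lambda>_. c)"
proof (induction k arbitrary: c)
  case (Suc k)
  show ?case
    by (rule Ck_on_SucI[where f' = "\<lambda>_ _. 0"]) (use Suc in auto)
qed simp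

lemma Ck_on_add:
  assumes "open S" "Ck_on k S f" "Ck_on k S g"
  shows "Ck_on k S (\<lambda>x. f x + g x)"
  using assms(2,3)
proof (induction k arbitrary: f g)
  case 0
  then show ?case by (auto intro: continuous_on_add)
next
  case (Suc k)
  show ?case
    by (rule Ck_on_SucI[OF assms(1), where
          f' = "\<lambda>x v. frechet_derivative f (at x) v + frechet_derivative g (at x) v"])
       (use Suc in \<open>auto intro!: has_derivative_add simp: frechet_derivative_works[symmetric]\<close>)
qed

lemma Ck_on_scaleR:
  assumes "open S" "Ck_on k S f" "Ck_on k S g"
  shows "Ck_on k S (\<lambda>x. f x *\<^sub>R g x)"
  using assms(2,3)
proof (induction k arbitrary: f g)
  case 0
  then show ?case by (auto intro: continuous_on_scaleR)
next
  case (Suc k)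
  show ?case
  proof (rule Ck_on_SucI[OF assms(1), where
          f' = "\<lambda>x v. f x *\<^sub>R frechet_derivative g (at x) v + frechet_derivative f (at x) v *\<^sub>R g x"])
    show "((\<lambda>x. f x *\<^sub>R g x) has_derivative
      (\<lambda>v. f x *\<^sub>R frechet_derivative g (at x) v + frechet_derivative f (at x) v *\<^sub>R g x)) (at x)"
      if "x \<in> S" for x
      using that Suc.prems by (intro has_derivative_scaleR) (auto simp: frechet_derivative_works[symmetric])
    show "Ck_on k S (\<lambda>x. f x *\<^sub>R frechet_derivative g (at x) v + frechet_derivative f (at x) v *\<^sub>R g x)" for v
      by (intro Ck_on_add Suc.IH assms) (use Suc.prems Ck_on_SucD in auto)
  qed
qed

lemma Ck_on_affine_inner:
  assumes "open S"
  shows "Ck_on k S (\<lambda>y. (y - z) \<bullet> v)"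
proof (cases k)
  case 0
  then show ?thesis by (auto intro!: continuous_intros)
next
  case (Suc j)
  show ?thesis unfolding Suc
    by (rule Ck_on_SucI[OF assms, where f' = "\<lambda>y w. w \<bullet> v"])
       (auto intro!: derivative_eq_intros Ck_on_const assms)
qed

section \<open>A smooth radially decreasing bump\<close>

text \<open>
  The functions \<open>p(1/t) exp(-1/t)\<close>, continued by zero: the class containing
  \<open>exp(-1/t)\<close> and closed under differentiation, which is what makes the bump
  smooth by induction.
\<close>

definition exp_flat :: "real poly \<Rightarrow> real \<Rightarrow> real" where
  "exp_flat p t = (if t > 0 then poly p (1 / t) * exp (- 1 / t) else 0)"

lemma poly_mult_exp_minus_tendsto_0:
  fixes p :: "real poly"
  shows "((\<lambda>s. poly p s * exp (- s)) \<longlongrightarrow> 0) at_top"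
proof -
  have *: "((\<lambda>s::real. s ^ k * exp (- s)) \<longlongrightarrow> 0) at_top" for k
    using tendsto_power_div_exp_0[of k] by (simp add: exp_minus divide_inverse)
  have "((\<lambda>s. \<Sum>i\<le>degree p. coeff p i * (s ^ i * exp (- s))) \<longlongrightarrow> (\<Sum>i\<le>degree p. coeff p i * 0)) at_top"
    by (intro tendsto_sum tendsto_mult tendsto_const *)
  then show ?thesis by (simp add: poly_altdef sum_distrib_right mult.assoc)
qed

lemma exp_flat_tendsto_0: "(exp_flat p \<longlongrightarrow> 0) (at_right 0)"
proof -
  have "((\<lambda>t. poly p (inverse t) * exp (- inverse t)) \<longlongrightarrow> 0) (at_right 0)"
    using poly_mult_exp_minus_tendsto_0[of p]
    by (simp add: filterlim_at_top_to_right)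
  then show ?thesis
    by (rule Lim_transform_eventually)
       (auto simp: exp_flat_def eventually_at_right_field inverse_eq_divide intro!: exI[of _ 1])
qed

text \<open>
  In the variable \<open>s = 1/t\<close> one has \<open>d/dt = - s\<^sup>2 d/ds\<close>, so
  \<open>p(s) exp(-s)\<close> is sent to \<open>s\<^sup>2 (p - p')(s) exp(-s)\<close>. At the
  origin the difference quotient is a function of the same class with \<open>p\<close>
  multiplied by \<open>s\<close>, hence tends to zero.
\<close>

lemma exp_flat_has_derivative:
  "(exp_flat p has_real_derivative exp_flat ([:0, 0, 1:] * (p - pderiv p)) t) (at t)"
proof -
  consider "t > 0" | "t < 0" | "t = 0" by linarith
  then show ?thesis
  proof cases
    case 1
    have "((\<lambda>t. poly p (1 / t) * exp (- 1 / t)) has_real_derivative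
        exp_flat ([:0, 0, 1:] * (p - pderiv p)) t) (at t)"
      using 1 unfolding exp_flat_def
      by (auto intro!: derivative_eq_intros simp: field_simps power2_eq_square)
    then show ?thesis
      by (rule has_field_derivative_transform_within_open[where S = "{0<..}"])
         (use 1 in \<open>auto simp: exp_flat_def\<close>)
  next
    case 2
    have "((\<lambda>t. 0) has_real_derivative exp_flat ([:0, 0, 1:] * (p - pderiv p)) t) (at t)"
      using 2 by (simp add: exp_flat_def)
    then show ?thesis
      by (rule has_field_derivative_transform_within_open[where S = "{..<0}"])
         (use 2 in \<open>auto simp: exp_flat_def\<close>)
  next
    case 3
    have "((\<lambda>y. exp_flat p y / y) \<longlongrightarrow> 0) (at_right 0)"
      using exp_flat_tendsto_0[of "[:0, 1:] * p"]
      by (rule Lim_transform_eventually)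
         (auto simp: exp_flat_def eventually_at_right_field intro!: exI[of _ 1])
    moreover have "((\<lambda>y. exp_flat p y / y) \<longlongrightarrow> 0) (at_left 0)"
      by (rule Lim_transform_eventually[OF tendsto_const])
         (auto simp: exp_flat_def eventually_at_left_field intro!: exI[of _ "-1"])
    ultimately have "((\<lambda>y. exp_flat p y / y) \<longlongrightarrow> 0) (at 0)"
      using filterlim_split_at_real by blast
    then show ?thesis
      using 3 by (simp add: has_field_derivative_iff exp_flat_def)
  qed
qed

text \<open>
  A function of \<open>e\<^sup>2 - |y - z|\<^sup>2\<close>, so that it is smooth also at the
  centre, supported in the closed \<open>e\<close>-ball around \<open>z\<close>, and symmetric
  in \<open>z\<close> and \<open>y\<close>. It is not normalised; mollification divides by its
  integral.
\<close>

definition bump :: "real \<Rightarrow> 'a::euclidean_space \<Rightarrow> 'a \<Rightarrow> real" where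
  "bump e z y = exp_flat 1 (e\<^sup>2 - (y - z) \<bullet> (y - z))"

text \<open>
  The gradient of the bump in \<open>y\<close>; the polynomial \<open>s\<^sup>2\<close>
  encodes the derivative of \<open>exp(-1/t)\<close>.
\<close>

definition bump_grad :: "real \<Rightarrow> 'a::euclidean_space \<Rightarrow> 'a \<Rightarrow> 'a" where
  "bump_grad e z y = (- 2 * exp_flat [:0, 0, 1:] (e\<^sup>2 - (y - z) \<bullet> (y - z))) *\<^sub>R (y - z)"

lemma exp_flat_radial_has_derivative:
  "((\<lambda>y. exp_flat p (r - (y - z) \<bullet> (y - z))) has_derivative
    (\<lambda>v. exp_flat ([:0, 0, 1:] * (p - pderiv p)) (r - (y - z) \<bullet> (y - z)) * (- 2 * ((y - z) \<bullet> v)))) (at y)"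
proof -
  have "((\<lambda>y. r - (y - z) \<bullet> (y - z)) has_derivative (\<lambda>v. - 2 * ((y - z) \<bullet> v))) (at y)"
    by (auto intro!: derivative_eq_intros simp: inner_commute)
  from has_derivative_compose[OF this exp_flat_has_derivative[unfolded has_field_derivative_def]]
  show ?thesis by simp
qed

lemma Ck_on_exp_flat_radial:
  "Ck_on k UNIV (\<lambda>y::'a::euclidean_space. exp_flat p (r - (y - z) \<bullet> (y - z)))"
proof (induction k arbitrary: p)
  case 0
  then show ?case
    using exp_flat_radial_has_derivative[THEN has_derivative_continuous]
    by (auto intro!: continuous_at_imp_continuous_on)
next
  case (Suc k)
  show ?case
  proof (rule Ck_on_SucI[OF open_UNIV exp_flat_radial_has_derivative])
    fix v
    have "Ck_on k UNIV (\<lambda>y. exp_flat ([:0, 0, 1:] * (p - pderiv p)) (r - (y - z) \<bullet> (y - z)) *\<^sub>R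
       (- 2) *\<^sub>R ((y - z) \<bullet> v))"
      by (intro Ck_on_scaleR Suc.IH Ck_on_affine_inner Ck_on_const open_UNIV)
    then show "Ck_on k UNIV (\<lambda>y. exp_flat ([:0, 0, 1:] * (p - pderiv p)) (r - (y - z) \<bullet> (y - z)) *
       (- 2 * ((y - z) \<bullet> v)))" by simp
  qed
qed

lemma bump_nonneg: "bump e z y \<ge> 0"
  by (simp add: bump_def exp_flat_def)

lemma exp_flat_radial_eq_0:
  assumes "y \<notin> cball z e" "e > 0"
  shows "exp_flat p (e\<^sup>2 - (y - z) \<bullet> (y - z)) = 0"
proof -
  have "e < norm (y - z)" using assms by (simp add: dist_norm norm_minus_commute)
  then have "e\<^sup>2 < (norm (y - z))\<^sup>2" using assms by (intro power_strict_mono) auto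
  then show ?thesis by (simp add: exp_flat_def power2_norm_eq_inner)
qed

lemma bump_eq_0: "y \<notin> cball z e \<Longrightarrow> e > 0 \<Longrightarrow> bump e z y = 0"
  and bump_grad_eq_0: "y \<notin> cball z e \<Longrightarrow> e > 0 \<Longrightarrow> bump_grad e z y = 0"
  by (simp_all add: bump_def bump_grad_def exp_flat_radial_eq_0 del: mem_cball)

lemma bump_pos_center: "e > 0 \<Longrightarrow> bump e z z > 0"
  by (simp add: bump_def exp_flat_def)

lemma bump_has_derivative: "(bump e z has_derivative (\<lambda>v. bump_grad e z y \<bullet> v)) (at y)"
  using exp_flat_radial_has_derivative[of 1 "e\<^sup>2" z y]
  unfolding bump_def[abs_def] bump_grad_def by (simp add: algebra_simps)

lemma bump_has_derivative_center: "((\<lambda>z. bump e z y) has_derivative (\<lambda>v. - (bump_grad e z y \<bullet> v))) (at z)"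
proof -
  have *: "(y - z) \<bullet> (y - z) = (z - y) \<bullet> (z - y)" for z
    by (simp add: inner_diff)
  then have "(\<lambda>z. bump e z y) = bump e y" by (auto simp: bump_def)
  moreover have "- bump_grad e z y = bump_grad e y z"
    by (simp add: bump_grad_def * scaleR_diff_right)
  ultimately show ?thesis
    using bump_has_derivative[of e y z] by (metis (no_types, lifting) ext inner_minus_left)
qed

text \<open>
  The gradient points towards the centre because the bump is radially decreasing.
\<close>

lemma inner_bump_grad: "norm (bump_grad e z y) * norm (y - z) = - (bump_grad e z y \<bullet> (y - z))"
  by (simp add: bump_grad_def exp_flat_def dot_square_norm power2_eq_square)

lemma continuous_exp_flat: "continuous_on UNIV (exp_flat p)"
  using exp_flat_has_derivative DERIV_isCont continuous_at_imp_continuous_on by blast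

lemma continuous_on_bump [continuous_intros]:
  "continuous_on S f \<Longrightarrow> continuous_on S g \<Longrightarrow> continuous_on S (\<lambda>x. bump e (f x) (g x))"
  unfolding bump_def
  by (rule continuous_on_compose2[OF continuous_exp_flat]) (auto intro!: continuous_intros)

lemma continuous_on_bump_grad [continuous_intros]:
  "continuous_on S f \<Longrightarrow> continuous_on S g \<Longrightarrow> continuous_on S (\<lambda>x. bump_grad e (f x) (g x))"
  unfolding bump_grad_def
  by (intro continuous_intros continuous_on_compose2[OF continuous_exp_flat]) auto

lemma bump_test_function:
  fixes z :: "real^'n::finite"
  assumes "e > 0" "cball z e \<subseteq> \<Omega>"
  shows "(\<lambda>y. bump e z y *\<^sub>R v) \<in> test_functions \<Omega>"
proof -
  have *: "closure {y. bump e z y *\<^sub>R v \<noteq> 0} \<subseteq> cball z e"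
    by (rule closure_minimal) (use bump_eq_0 assms in \<open>auto simp del: mem_cball\<close>)
  moreover have "compact (closure {y. bump e z y *\<^sub>R v \<noteq> 0})"
    using * by (meson bounded_cball bounded_subset closed_closure compact_eq_bounded_closed)
  moreover have "Ck_on k UNIV (\<lambda>y. bump e z y *\<^sub>R v)" for k
    unfolding bump_def by (intro Ck_on_scaleR Ck_on_exp_flat_radial Ck_on_const open_UNIV)
  ultimately show ?thesis
    using assms by (auto simp: test_functions_def smooth_on_def)
qed

section \<open>The divergence theorem for compactly supported fields\<close>

text \<open>
  The integral over the box is the integral over the whole space, which is translation
  invariant.
\<close>

lemma integral_translate_compact_support:
  fixes F :: "'a::euclidean_space \<Rightarrow> real"
  assumes cont: "continuous_on (cbox a b) F" and supp: "\<And>y. y \<notin> S \<Longrightarrow> F y = 0"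
    and S: "\<And>y. y \<in> S \<Longrightarrow> y \<in> cbox a b \<and> y - c \<in> cbox a b"
  shows "integral (cbox a b) (\<lambda>y. F (y + c)) = integral (cbox a b) F"
proof -
  have "(F has_integral integral (cbox a b) F) (cbox a b)"
    using cont by (intro integrable_integral integrable_continuous)
  then have "(F has_integral integral (cbox a b) F) UNIV"
    by (rule has_integral_on_superset) (use supp S in auto)
  moreover have "F = (\<lambda>y. if y \<in> cbox (a + c) (b + c) then F y else 0)"
  proof
    fix y
    have "y \<in> cbox (a + c) (b + c)" if "y \<in> S"
      using S[OF that] by (auto simp: mem_box inner_simps algebra_simps)
    then show "F y = (if y \<in> cbox (a + c) (b + c) then F y else 0)" using supp by auto
  qed
  ultimately have "(F has_integral integral (cbox a b) F) (cbox (a + c) (b + c))"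
    by (metis has_integral_restrict_UNIV)
  then have "((F \<circ> (+) c) has_integral integral (cbox a b) F) (cbox a b)"
    by (simp add: has_integral_shift_cbox_iff)
  then show ?thesis
    by (simp add: o_def add.commute integral_unique)
qed

text \<open>
  The integral of the translate \<open>F(y + s v)\<close> does not depend on \<open>s\<close>
  near zero; differentiating under the integral sign gives the claim. This replaces
  integrating out one coordinate by Fubini's theorem.
\<close>

lemma integral_directional_derivative_eq_0:
  fixes F :: "'a::euclidean_space \<Rightarrow> real"
  assumes der: "\<And>y. (F has_derivative F' y) (at y)"
    and cont: "continuous_on UNIV (\<lambda>y. F' y v)"
    and S: "compact S" "S \<subseteq> box a b" "\<And>y. y \<notin> S \<Longrightarrow> F y = 0"
  shows "integral (cbox a b) (\<lambda>y. F' y v) = 0"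
proof -
  obtain e where e: "e > 0" "(\<Union>x\<in>S. cball x e) \<subseteq> box a b"
    using compact_subset_open_imp_cball_epsilon_subset[OF S(1) open_box S(2)] by metis
  define d where "d = e / (norm v + 1)"
  have d: "d > 0" using e by (simp add: d_def add_nonneg_pos)
  define U where "U = {-d<..<d}"
  have at0: "at 0 within U = at 0" using d by (intro at_within_open) (auto simp: U_def)
  have contF: "continuous_on A F" for A
    using der by (meson continuous_at_imp_continuous_on has_derivative_continuous)
  have const: "integral (cbox a b) (\<lambda>y. F (y + s *\<^sub>R v)) = integral (cbox a b) F" if "s \<in> U" for s
  proof (rule integral_translate_compact_support[OF contF S(3)])
    fix y assume y: "y \<in> S"
    have "norm (s *\<^sub>R v) \<le> d * (norm v + 1)"
      using that d unfolding norm_scaleR U_def by (intro mult_mono) auto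
    also have "\<dots> = e" by (simp add: d_def add_nonneg_eq_0_iff)
    finally have "y - s *\<^sub>R v \<in> cball y e" by (simp add: dist_norm)
    then have "y - s *\<^sub>R v \<in> box a b" using e(2) y by blast
    then show "y \<in> cbox a b \<and> y - s *\<^sub>R v \<in> cbox a b"
      using S(2) y box_subset_cbox by blast
  qed
  have "((\<lambda>s. integral (cbox a b) (\<lambda>y. F (y + s *\<^sub>R v))) has_field_derivative
      integral (cbox a b) (\<lambda>y. F' (y + 0 *\<^sub>R v) v)) (at 0 within U)"
  proof (rule leibniz_rule_field_derivative)
    show "((\<lambda>s. F (y + s *\<^sub>R v)) has_field_derivative F' (y + s *\<^sub>R v) v) (at s within U)" for s y
    proof -
      have "((\<lambda>s. y + s *\<^sub>R v) has_derivative (\<lambda>t. t *\<^sub>R v)) (at s within U)"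
        by (auto intro!: derivative_eq_intros)
      from has_derivative_compose[OF this der]
      have "((\<lambda>s. F (y + s *\<^sub>R v)) has_derivative (\<lambda>t. F' (y + s *\<^sub>R v) (t *\<^sub>R v))) (at s within U)" .
      moreover have "F' (y + s *\<^sub>R v) (t *\<^sub>R v) = F' (y + s *\<^sub>R v) v * t" for t
        using has_derivative_bounded_linear[OF der] by (simp add: linear_simps)
      ultimately show ?thesis by (simp add: has_field_derivative_def)
    qed
    show "(\<lambda>y. F (y + s *\<^sub>R v)) integrable_on cbox a b" for s
      by (intro integrable_continuous continuous_on_compose2[OF contF[of UNIV]] continuous_intros) auto
    show "continuous_on (U \<times> cbox a b) (\<lambda>(s, y). F' (y + s *\<^sub>R v) v)"
      unfolding case_prod_unfold
      by (intro continuous_on_compose2[OF cont] continuous_intros) auto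
  qed (use d in \<open>auto simp: U_def\<close>)
  then have "((\<lambda>s. integral (cbox a b) (\<lambda>y. F (y + s *\<^sub>R v))) has_field_derivative
      integral (cbox a b) (\<lambda>y. F' y v)) (at 0)"
    by (simp only: at0 scaleR_zero_left add_0_right)
  then have "((\<lambda>s. integral (cbox a b) F) has_field_derivative integral (cbox a b) (\<lambda>y. F' y v)) (at 0)"
    by (rule has_field_derivative_transform_within_open[where S = U])
       (use d const in \<open>auto simp: U_def\<close>)
  then show ?thesis using DERIV_const DERIV_unique by blast
qed

lemma divergence_eq_sum:
  assumes "(F has_derivative F') (at y)"
  shows "divergence F y = (\<Sum>i\<in>UNIV. F' (axis i 1) $ i)"
proof -
  have "((\<lambda>y. F y $ i) has_derivative (\<lambda>v. F' v $ i)) (at y)" for i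
    using assms bounded_linear.has_derivative[OF bounded_linear_vec_nth] by blast
  then show ?thesis unfolding divergence_def
    by (metis (no_types, lifting) frechet_derivative_at sum.cong)
qed

lemma integral_divergence_eq_0:
  fixes F :: "real^'n::finite \<Rightarrow> real^'n"
  assumes der: "\<And>y. (F has_derivative F' y) (at y)"
    and cont: "\<And>v. continuous_on UNIV (\<lambda>y. F' y v)"
    and S: "compact S" "S \<subseteq> box a b" "\<And>y. y \<notin> S \<Longrightarrow> F y = 0"
  shows "integral (cbox a b) (divergence F) = 0"
proof -
  have *: "continuous_on UNIV (\<lambda>y. F' y (axis i 1) $ i)" for i
    by (intro continuous_intros cont)
  have "integral (cbox a b) (divergence F) = integral (cbox a b) (\<lambda>y. \<Sum>i\<in>UNIV. F' y (axis i 1) $ i)"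
    by (simp add: divergence_eq_sum[OF der] cong: integral_cong)
  also have "\<dots> = (\<Sum>i\<in>UNIV. integral (cbox a b) (\<lambda>y. F' y (axis i 1) $ i))"
    by (intro integral_sum integrable_continuous continuous_on_subset[OF *]) auto
  also have "\<dots> = 0"
  proof (rule sum.neutral, rule ballI)
    fix i :: 'n
    show "integral (cbox a b) (\<lambda>y. F' y (axis i 1) $ i) = 0"
      using der by (intro integral_directional_derivative_eq_0[where F = "\<lambda>y. F y $ i" and S = S and
            F' = "\<lambda>y v. F' y v $ i"] bounded_linear.has_derivative[OF bounded_linear_vec_nth] * S)
            (auto simp: S)
  qed
  finally show ?thesis .
qed

lemma bump_scaleR_has_derivative:
  assumes "(c has_derivative c') (at y)"
  shows "((\<lambda>y. bump e z y *\<^sub>R c y) has_derivative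
    (\<lambda>v. bump e z y *\<^sub>R c' v + (bump_grad e z y \<bullet> v) *\<^sub>R c y)) (at y)"
  using bump_has_derivative assms by (rule has_derivative_scaleR)

lemma divergence_bump_scaleR:
  fixes c :: "real^'n::finite \<Rightarrow> real^'n"
  assumes "c differentiable (at y)"
  shows "divergence (\<lambda>y. bump e z y *\<^sub>R (c y - q)) y =
    bump_grad e z y \<bullet> (c y - q) + bump e z y * divergence c y"
proof -
  obtain c' where c': "(c has_derivative c') (at y)" using assms by (auto simp: differentiable_def)
  have "((\<lambda>y. c y - q) has_derivative c') (at y)"
    using has_derivative_diff[OF c' has_derivative_const] by simp
  from divergence_eq_sum[OF bump_scaleR_has_derivative[OF this]] divergence_eq_sum[OF c'] show ?thesis
    by (simp add: sum.distrib sum_distrib_left inner_vec_def[of _ "c y - q"] inner_axis)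
qed

lemma continuous_on_divergence:
  assumes "Ck_on (Suc 0) \<Omega> c"
  shows "continuous_on \<Omega> (divergence c)"
proof -
  have "continuous_on \<Omega> (\<lambda>y. \<Sum>i\<in>UNIV. frechet_derivative c (at y) (axis i 1) $ i)"
    using assms by (intro continuous_on_sum continuous_on_component) simp
  moreover have "divergence c y = (\<Sum>i\<in>UNIV. frechet_derivative c (at y) (axis i 1) $ i)" if "y \<in> \<Omega>" for y
    using assms that by (intro divergence_eq_sum) (simp flip: frechet_derivative_works)
  ultimately show ?thesis by (simp cong: continuous_on_cong)
qed

lemma divergence_id: "divergence (\<lambda>y. y :: real^'n::finite) y = CARD('n)"
  by (subst divergence_eq_sum[OF has_derivative_ident]) simp

text \<open>
  The field \<open>c\<close> lives only on \<open>\<Omega>\<close>, but its product with the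
  bump extends by zero to a continuously differentiable field with compact support inside the
  box.
\<close>

lemma integral_divergence_bump_eq_0:
  fixes c :: "real^'n::finite \<Rightarrow> real^'n"
  assumes \<Omega>: "open \<Omega>" "cbox a b \<subseteq> \<Omega>" and c: "Ck_on (Suc 0) \<Omega> c"
    and e: "e > 0" "cball z e \<subseteq> box a b"
  shows "integral (cbox a b) (\<lambda>y. bump_grad e z y \<bullet> (c y - q) + bump e z y * divergence c y) = 0"
proof -
  define F where "F y = bump e z y *\<^sub>R (c y - q)" for y
  define F' where "F' y v = bump e z y *\<^sub>R frechet_derivative c (at y) v + (bump_grad e z y \<bullet> v) *\<^sub>R (c y - q)" for y v
  have off: "F y = 0" "F' y v = 0" if "y \<in> - cball z e" for y v
  proof -
    have "bump e z y = 0" "bump_grad e z y = 0"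
      using that e(1) by (intro bump_eq_0 bump_grad_eq_0; blast)+
    then show "F y = 0" "F' y v = 0" by (simp_all add: F_def F'_def)
  qed
  have sub: "cball z e \<subseteq> \<Omega>" using \<Omega> e box_subset_cbox[of a b] by order
  then have cover: "\<Omega> \<union> - cball z e = UNIV" by blast
  have "(F has_derivative F' y) (at y)" for y
  proof (cases "y \<in> \<Omega>")
    case True
    then have "(c has_derivative frechet_derivative c (at y)) (at y)"
      using c by (simp flip: frechet_derivative_works)
    from has_derivative_diff[OF this has_derivative_const]
    have "((\<lambda>y. c y - q) has_derivative frechet_derivative c (at y)) (at y)" by simp
    from bump_scaleR_has_derivative[OF this] show ?thesis by (simp add: F_def[abs_def] F'_def[abs_def])
  next
    case False
    then have y: "y \<in> - cball z e" using sub by blast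
    have "((\<lambda>_. 0) has_derivative F' y) (at y)" using off(2)[OF y, abs_def] by simp
    then show ?thesis
      by (rule has_derivative_transform_within_open[OF _ open_Compl[OF closed_cball] y]) (use off(1) in auto)
  qed
  moreover have "continuous_on UNIV (\<lambda>y. F' y v)" for v
  proof -
    have "continuous_on \<Omega> (\<lambda>y. F' y v)"
    proof -
      have "continuous_on \<Omega> (\<lambda>y. frechet_derivative c (at y) v)" using c by simp
      then show ?thesis unfolding F'_def
        using Ck_on_imp_continuous_on[OF c]
        by (intro continuous_on_add continuous_on_scaleR continuous_on_diff continuous_on_inner
            continuous_on_bump continuous_on_bump_grad continuous_on_const continuous_on_id)
    qed
    moreover have "continuous_on (- cball z e) (\<lambda>y. F' y v)"
      by (rule continuous_on_eq[OF continuous_on_const]) (use off(2) in auto)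
    ultimately show ?thesis
      using continuous_on_open_Un[of \<Omega> "- cball z e"] \<Omega>(1) cover by (metis closed_cball open_Compl)
  qed
  ultimately have "integral (cbox a b) (divergence F) = 0"
    by (rule integral_divergence_eq_0[where S = "cball z e"]) (use off e in auto)
  moreover have "divergence F y = bump_grad e z y \<bullet> (c y - q) + bump e z y * divergence c y"
    if "y \<in> cbox a b" for y
    unfolding F_def[abs_def] using c that \<Omega> by (intro divergence_bump_scaleR) auto
  ultimately show ?thesis by (simp cong: integral_cong)
qed

text \<open>
  Applying the divergence theorem to the field \<open>(y - z) k(y)\<close>, whose divergence
  is \<open>\<nabla>k \<bullet> (y - z) + n k\<close>, and using that \<open>\<nabla>k\<close>
  is antiparallel to \<open>y - z\<close>. This bounds the singular factor of the commutator
  uniformly in the radius of the bump, without rescaling.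
\<close>

lemma integral_bump_grad_moment:
  fixes z :: "real^'n::finite"
  assumes e: "e > 0" "cball z e \<subseteq> box a b"
  shows "integral (cbox a b) (\<lambda>y. norm (bump_grad e z y) * norm (y - z)) =
    CARD('n) * integral (cbox a b) (bump e z)"
proof -
  have "Ck_on (Suc 0) UNIV (\<lambda>y. y :: real^'n)"
    by (rule Ck_on_SucI[where f' = "\<lambda>_ v. v"]) auto
  from integral_divergence_bump_eq_0[OF open_UNIV _ this e, of z]
  have "0 = integral (cbox a b) (\<lambda>y. bump_grad e z y \<bullet> (y - z) + CARD('n) * bump e z y)"
    by (simp add: divergence_id mult.commute)
  also have "\<dots> = integral (cbox a b) (\<lambda>y. bump_grad e z y \<bullet> (y - z)) +
      integral (cbox a b) (\<lambda>y. CARD('n) * bump e z y)"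
    by (intro integral_add integrable_continuous continuous_intros)
  finally show ?thesis by (simp add: inner_bump_grad)
qed

section \<open>Friedrichs mollification along vector fields\<close>

lemma set_lebesgue_integral_eq_integral_cbox:
  fixes f :: "'a::euclidean_space \<Rightarrow> real"
  assumes "cbox a b \<subseteq> \<Omega>" "continuous_on (cbox a b) f" "\<And>y. y \<in> \<Omega> \<Longrightarrow> y \<notin> cbox a b \<Longrightarrow> f y = 0"
  shows "(LINT y:\<Omega>|lebesgue. f y) = integral (cbox a b) f"
proof -
  have "(LINT y:\<Omega>|lebesgue. f y) = (LINT y:cbox a b|lebesgue. f y)"
    unfolding set_lebesgue_integral_def
    by (rule Bochner_Integration.integral_cong) (use assms in \<open>auto simp: indicator_def\<close>)
  also have "\<dots> = integral (cbox a b) f"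
    using assms(2) by (intro set_lebesgue_integral_eq_integral(2) absolutely_integrable_continuous)
  finally show ?thesis .
qed

lemma vector_mult_coeff_matrix: "v v* coeff_matrix X y = (\<Sum>j\<in>UNIV. v $ j *\<^sub>R X j y)"
  by (simp add: vec_eq_iff vector_matrix_mult_def coeff_matrix_def mult.commute)

lemma scaled_axis_mult_coeff_matrix: "(r *\<^sub>R axis j 1) v* coeff_matrix X y = r *\<^sub>R X j y"
  by (simp add: vector_mult_coeff_matrix axis_def if_distrib[of "\<lambda>t. _ * t"]
      if_distrib[of "\<lambda>t. t *\<^sub>R _"] cong: if_cong)

text \<open>
  The distributional identity tested on the vector field with the bump in slot
  \<open>j\<close>. It is written over a box, where the calculus of parameter integrals is
  available; the bump vanishes outside.
\<close>

lemma hgrad_tested_on_bump: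
  fixes \<Omega> :: "(real^'n::finite) set" and X :: "'m::finite \<Rightarrow> real^'n \<Rightarrow> real^'n"
  assumes \<Omega>: "open \<Omega>" "cbox a b \<subseteq> \<Omega>" and X: "Ck_on (Suc 0) \<Omega> (X j)"
    and u: "continuous_on \<Omega> u" and g: "continuous_hgrad \<Omega> X u g"
    and e: "e > 0" "cball z e \<subseteq> box a b"
  shows "integral (cbox a b) (\<lambda>y. u y * (bump_grad e z y \<bullet> X j y + bump e z y * divergence (X j) y)) =
    - integral (cbox a b) (\<lambda>y. g y $ j * bump e z y)"
proof -
  have sub: "cball z e \<subseteq> cbox a b" "cball z e \<subseteq> \<Omega>"
    using \<Omega> e box_subset_cbox[of a b] by order+
  have div: "divergence (\<lambda>y. (bump e z y *\<^sub>R axis j 1) v* coeff_matrix X y) y =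
      bump_grad e z y \<bullet> X j y + bump e z y * divergence (X j) y" if "y \<in> \<Omega>" for y
    using divergence_bump_scaleR[of "X j" y e z 0] X that
    by (simp add: scaled_axis_mult_coeff_matrix)
  have off: "bump e z y = 0" "bump_grad e z y = 0" if "y \<notin> cbox a b" for y
    using that sub(1) e(1) by (intro bump_eq_0 bump_grad_eq_0; blast)+
  have cont: "continuous_on (cbox a b) u" "continuous_on (cbox a b) (X j)" "continuous_on (cbox a b) g"
      "continuous_on (cbox a b) (divergence (X j))"
    using \<Omega> u Ck_on_imp_continuous_on[OF X] g continuous_on_divergence[OF X] continuous_on_subset
    unfolding continuous_hgrad_def by blast+
  have "- (LINT y:\<Omega>|lebesgue. u y * divergence (\<lambda>y. (bump e z y *\<^sub>R axis j 1) v* coeff_matrix X y) y) =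
    (LINT y:\<Omega>|lebesgue. g y \<bullet> (bump e z y *\<^sub>R axis j 1))"
    using g[unfolded continuous_hgrad_def distr_hgrad_def, THEN conjunct2, THEN bspec,
        OF bump_test_function[OF e(1) sub(2)]] .
  moreover have "(LINT y:\<Omega>|lebesgue. g y \<bullet> (bump e z y *\<^sub>R axis j 1)) =
      integral (cbox a b) (\<lambda>y. g y \<bullet> (bump e z y *\<^sub>R axis j 1))"
    by (rule set_lebesgue_integral_eq_integral_cbox) (use \<Omega> off in \<open>auto intro!: continuous_intros cont\<close>)
  moreover have "(LINT y:\<Omega>|lebesgue. u y * divergence (\<lambda>y. (bump e z y *\<^sub>R axis j 1) v* coeff_matrix X y) y) =
      (LINT y:\<Omega>|lebesgue. u y * (bump_grad e z y \<bullet> X j y + bump e z y * divergence (X j) y))"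
    unfolding set_lebesgue_integral_def
    by (rule Bochner_Integration.integral_cong) (auto simp: indicator_def div)
  moreover have "\<dots> = integral (cbox a b) (\<lambda>y. u y * (bump_grad e z y \<bullet> X j y + bump e z y * divergence (X j) y))"
    by (rule set_lebesgue_integral_eq_integral_cbox) (use \<Omega> off in \<open>auto intro!: continuous_intros cont\<close>)
  ultimately show ?thesis by (simp add: inner_axis mult.commute)
qed


text \<open>
  Friedrichs' commutator estimate. With \<open>h\<close> the weak derivative of
  \<open>u\<close> along \<open>c\<close> and \<open>*\<close> convolution, the difference
  between \<open>c \<bullet> \<nabla>(u * k)(z)\<close> and \<open>(h * k)(z)\<close> is, by
  the weak identity, the integral of \<open>u div ((c - c(z)) k)\<close>. The divergence has
  integral zero, so \<open>u\<close> may be replaced by \<open>u - u(z)\<close>, which is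
  small; the remaining factor is bounded by the first moment of \<open>\<nabla>k\<close>
  because \<open>c\<close> is Lipschitz. The two terms are added because differentiating the
  bump in its centre reverses a sign.
\<close>

lemma mollifier_commutator_bound:
  fixes c :: "real^'n::finite \<Rightarrow> real^'n"
  assumes \<Omega>: "open \<Omega>" "cbox a b \<subseteq> \<Omega>" and c: "Ck_on (Suc 0) \<Omega> c"
    and u: "continuous_on (cbox a b) u" and h: "continuous_on (cbox a b) h"
    and e: "e > 0" "cball z e \<subseteq> box a b"
    and weak: "integral (cbox a b) (\<lambda>y. u y * (bump_grad e z y \<bullet> c y + bump e z y * divergence c y)) =
      - integral (cbox a b) (\<lambda>y. h y * bump e z y)"
    and lip: "\<And>y. y \<in> cball z e \<Longrightarrow> norm (c y - c z) \<le> L * norm (y - z)"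
    and D: "\<And>y. y \<in> cball z e \<Longrightarrow> \<bar>divergence c y\<bar> \<le> D"
    and w: "\<And>y. y \<in> cball z e \<Longrightarrow> \<bar>u y - u z\<bar> \<le> w"
  shows "\<bar>integral (cbox a b) (\<lambda>y. u y * (bump_grad e z y \<bullet> c z)) + integral (cbox a b) (\<lambda>y. h y * bump e z y)\<bar>
    \<le> w * (L * CARD('n) + D) * integral (cbox a b) (bump e z)"
proof -
  let ?I = "integral (cbox a b)"
  have c_cont: "continuous_on (cbox a b) c" "continuous_on (cbox a b) (divergence c)"
    using Ck_on_imp_continuous_on[OF c] continuous_on_divergence[OF c] \<Omega>(2) continuous_on_subset by blast+
  note cont = continuous_intros c_cont u h
  define Q where "Q y = bump_grad e z y \<bullet> (c y - c z) + bump e z y * divergence c y" for y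
  have Q0: "?I Q = 0"
    using integral_divergence_bump_eq_0[OF \<Omega> c e] by (simp add: Q_def[abs_def])
  have Qc: "continuous_on (cbox a b) Q" unfolding Q_def by (intro cont)
  have "?I (\<lambda>y. (u y - u z) * Q y) = ?I (\<lambda>y. u y * Q y - u z * Q y)"
    by (simp add: left_diff_distrib)
  also have "\<dots> = ?I (\<lambda>y. u y * Q y) - ?I (\<lambda>y. u z * Q y)"
    by (intro integral_diff integrable_continuous cont Qc)
  also have "\<dots> = ?I (\<lambda>y. u y * Q y)" using Q0 by simp
  also have "\<dots> = ?I (\<lambda>y. u y * (bump_grad e z y \<bullet> c y + bump e z y * divergence c y) -
      u y * (bump_grad e z y \<bullet> c z))"
    by (simp add: Q_def inner_diff_right algebra_simps)
  also have "\<dots> = ?I (\<lambda>y. u y * (bump_grad e z y \<bullet> c y + bump e z y * divergence c y)) -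
      ?I (\<lambda>y. u y * (bump_grad e z y \<bullet> c z))"
    by (intro integral_diff integrable_continuous cont)
  finally have eq: "?I (\<lambda>y. u y * (bump_grad e z y \<bullet> c z)) + ?I (\<lambda>y. h y * bump e z y) =
      - ?I (\<lambda>y. (u y - u z) * Q y)"
    using weak by simp
  have "norm (?I (\<lambda>y. (u y - u z) * Q y)) \<le>
      ?I (\<lambda>y. w * (L * (norm (bump_grad e z y) * norm (y - z)) + D * bump e z y))"
  proof (rule integral_norm_bound_integral)
    fix y assume "y \<in> cbox a b"
    show "norm ((u y - u z) * Q y) \<le> w * (L * (norm (bump_grad e z y) * norm (y - z)) + D * bump e z y)"
    proof (cases "y \<in> cball z e")
      case True
      have "\<bar>Q y\<bar> \<le> norm (bump_grad e z y) * norm (c y - c z) + bump e z y * \<bar>divergence c y\<bar>"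
        using Cauchy_Schwarz_ineq2[of "bump_grad e z y" "c y - c z"] bump_nonneg[of e z y]
        unfolding Q_def by (intro order_trans[OF abs_triangle_ineq] add_mono) (auto simp: abs_mult)
      also have "\<dots> \<le> norm (bump_grad e z y) * (L * norm (y - z)) + bump e z y * D"
        using lip D True bump_nonneg by (intro add_mono mult_left_mono) auto
      finally have "\<bar>Q y\<bar> \<le> L * (norm (bump_grad e z y) * norm (y - z)) + D * bump e z y"
        by (simp add: algebra_simps)
      then show ?thesis
        unfolding real_norm_def abs_mult using w[OF True] order_trans[OF abs_ge_zero w[OF True]]
        by (intro mult_mono) auto
    next
      case False
      then show ?thesis using e(1) by (simp add: Q_def bump_eq_0 bump_grad_eq_0 del: mem_cball)
    qed
  qed (intro integrable_continuous cont Qc)+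
  also have "\<dots> = w * (L * ?I (\<lambda>y. norm (bump_grad e z y) * norm (y - z)) + D * ?I (bump e z))"
  proof -
    have "?I (\<lambda>y. L * (norm (bump_grad e z y) * norm (y - z)) + D * bump e z y) =
      ?I (\<lambda>y. L * (norm (bump_grad e z y) * norm (y - z))) + ?I (\<lambda>y. D * bump e z y)"
      by (intro integral_add integrable_continuous cont)
    then show ?thesis by simp
  qed
  also have "\<dots> = w * (L * CARD('n) + D) * ?I (bump e z)"
    unfolding integral_bump_grad_moment[OF e] by (simp add: algebra_simps)
  finally show ?thesis using eq by simp
qed

lemma integral_bump_eq:
  assumes "e > 0" "cball z e \<subseteq> cbox a b" "cball z' e \<subseteq> cbox a b"
  shows "integral (cbox a b) (bump e z) = integral (cbox a b) (bump e z')"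
proof -
  have "integral (cbox a b) (\<lambda>y. bump e z' (y + (z' - z))) = integral (cbox a b) (bump e z')"
  proof (rule integral_translate_compact_support)
    show "continuous_on (cbox a b) (bump e z')" by (intro continuous_intros)
    show "bump e z' y = 0" if "y \<notin> cball z' e" for y using bump_eq_0[OF that assms(1)] .
    show "y \<in> cbox a b \<and> y - (z' - z) \<in> cbox a b" if "y \<in> cball z' e" for y
    proof -
      have "y - (z' - z) \<in> cball z e" using that by (simp add: dist_norm algebra_simps)
      then show ?thesis using that assms by blast
    qed
  qed
  moreover have "bump e z' (y + (z' - z)) = bump e z y" for y by (simp add: bump_def)
  ultimately show ?thesis by simp
qed

lemma integral_bump_pos:
  assumes "e > 0" "z \<in> box a b"
  shows "integral (cbox a b) (bump e z) > 0"
proof -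
  have "continuous_on (cbox a b) (bump e z)" by (intro continuous_intros)
  moreover have "z \<in> cbox a b" "box a b \<noteq> {}" using assms(2) box_subset_cbox by blast+
  moreover have "bump e z z \<noteq> 0" using bump_pos_center[OF assms(1), of z] by simp
  ultimately have "integral (cbox a b) (bump e z) \<noteq> 0"
    using integral_cbox_eq_0_iff[of a b "bump e z"] bump_nonneg by blast
  moreover have "integral (cbox a b) (bump e z) \<ge> 0"
    by (intro integral_nonneg integrable_continuous continuous_intros) (auto intro: bump_nonneg)
  ultimately show ?thesis by simp
qed

text \<open>
  Differentiation under the integral sign. The derivative falls on the centre of the bump,
  hence the minus sign.
\<close>

lemma mollification_has_derivative:
  fixes u :: "'a::euclidean_space \<Rightarrow> real" and e :: real
  assumes u: "continuous_on (cbox a b) u"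
  defines "G \<equiv> \<lambda>z. integral (cbox a b) (\<lambda>y. - u y *\<^sub>R bump_grad e z y)"
  shows "((\<lambda>z. integral (cbox a b) (\<lambda>y. u y * bump e z y)) has_derivative (\<lambda>v. G z \<bullet> v)) (at z)"
    and "continuous_on UNIV G"
proof -
  have u': "continuous_on (UNIV \<times> cbox a b) (\<lambda>p. u (snd p))"
    by (rule continuous_on_compose2[OF u]) (auto intro!: continuous_intros)
  have cont: "continuous_on (UNIV \<times> cbox a b) (\<lambda>(z, y). - u y *\<^sub>R bump_grad e z y)"
    unfolding case_prod_unfold by (intro continuous_intros u')
  then show "continuous_on UNIV G"
    unfolding G_def by (rule integral_continuous_on_param)
  define B where "B z y = blinfun_inner_left (- u y *\<^sub>R bump_grad e z y)" for z y :: 'a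
  have contB: "continuous_on (UNIV \<times> cbox a b) (\<lambda>(z, y). B z y)"
    using cont unfolding B_def case_prod_unfold
    by (intro bounded_linear.continuous_on[OF bounded_linear_blinfun_inner_left])
  have "((\<lambda>z. integral (cbox a b) (\<lambda>y. u y * bump e z y)) has_derivative
      blinfun_apply (integral (cbox a b) (B z))) (at z within UNIV)"
  proof (rule leibniz_rule[OF _ _ contB])
    show "((\<lambda>z. u y * bump e z y) has_derivative blinfun_apply (B z y)) (at z within UNIV)" for z y
      using has_derivative_mult_right[OF bump_has_derivative_center[of e y z], of "u y"]
      by (simp add: B_def inner_commute)
    show "(\<lambda>y. u y * bump e z y) integrable_on cbox a b" for z
      by (intro integrable_continuous continuous_intros u)
  qed auto
  moreover have "integral (cbox a b) (B z) = blinfun_inner_left (G z)"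
    unfolding B_def G_def
    by (subst integral_linear[OF _ bounded_linear_blinfun_inner_left, symmetric])
       (auto simp: o_def intro!: integrable_continuous continuous_intros u)
  ultimately show "((\<lambda>z. integral (cbox a b) (\<lambda>y. u y * bump e z y)) has_derivative (\<lambda>v. G z \<bullet> v)) (at z)"
    by (simp add: inner_commute)
qed


lemma C1_lipschitz_on_cbox:
  fixes c :: "'a::euclidean_space \<Rightarrow> 'b::real_normed_vector"
  assumes c: "Ck_on (Suc 0) \<Omega> c" and \<Omega>: "cbox a b \<subseteq> \<Omega>"
  obtains L where "L \<ge> 0" "\<And>y z. y \<in> cbox a b \<Longrightarrow> z \<in> cbox a b \<Longrightarrow> norm (c y - c z) \<le> L * norm (y - z)"
proof -
  define M where "M y = (\<Sum>i\<in>Basis. norm (frechet_derivative c (at y) i))" for y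
  have "continuous_on (cbox a b) M"
  proof -
    have "continuous_on (cbox a b) (\<lambda>y. frechet_derivative c (at y) i)" for i
    proof -
      have "continuous_on \<Omega> (\<lambda>y. frechet_derivative c (at y) i)" using c by simp
      then show ?thesis by (rule continuous_on_subset[OF _ \<Omega>])
    qed
    then show ?thesis unfolding M_def by (intro continuous_on_sum continuous_on_norm)
  qed
  then have "bounded (M ` cbox a b)"
    by (intro compact_imp_bounded compact_continuous_image) auto
  then obtain L where L: "L > 0" "\<And>y. y \<in> cbox a b \<Longrightarrow> norm (M y) \<le> L"
    unfolding bounded_pos by blast
  show ?thesis
  proof (rule that[of L])
    fix y z assume yz: "y \<in> cbox a b" "z \<in> cbox a b"
    show "norm (c y - c z) \<le> L * norm (y - z)"
    proof (rule differentiable_bound[OF convex_box(1) _ _ yz])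
      fix x assume x: "x \<in> cbox a b"
      then have d: "(c has_derivative frechet_derivative c (at x)) (at x)"
        using c \<Omega> by (auto simp flip: frechet_derivative_works)
      then show "(c has_derivative frechet_derivative c (at x)) (at x within cbox a b)"
        by (rule has_derivative_at_withinI)
      have "onorm (frechet_derivative c (at x)) \<le> M x"
        unfolding M_def by (rule onorm_componentwise[OF has_derivative_bounded_linear[OF d]])
      then show "onorm (frechet_derivative c (at x)) \<le> L" using L(2)[OF x] by simp
    qed
  qed (use L in simp)
qed

lemma compact_uniform_modulus:
  fixes f :: "'a::metric_space \<Rightarrow> 'b::real_normed_vector"
  assumes "compact Q" "continuous_on Q f" "\<epsilon> > 0"
  obtains d where "d > 0" "\<And>y z. y \<in> Q \<Longrightarrow> z \<in> Q \<Longrightarrow> dist y z < d \<Longrightarrow> norm (f y - f z) \<le> \<epsilon>"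
  using compact_uniformly_continuous[OF assms(2,1)] assms(3)
  unfolding uniformly_continuous_on_def dist_norm[of "f _"] by (meson less_imp_le)

text \<open>
  Mollifying with a bump of small radius \<open>e\<close>. Averages of \<open>u\<close> and
  \<open>g\<close> against the bump are close to their values by uniform continuity, and the
  commutator bound controls the error made by moving \<open>X\<^sub>j\<close> through the
  average.
\<close>

lemma friedrichs_approximation:
  fixes \<Omega> :: "(real^'n::finite) set" and X :: "'m::finite \<Rightarrow> real^'n \<Rightarrow> real^'n"
  assumes \<Omega>: "open \<Omega>" "cbox a b \<subseteq> \<Omega>" and X: "\<And>j. Ck_on (Suc 0) \<Omega> (X j)"
    and u: "continuous_on \<Omega> u" and g: "continuous_hgrad \<Omega> X u g"
    and K: "compact K" "K \<subseteq> box a b" and \<tau>: "\<tau> > 0"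
  obtains U G where "\<And>z. (U has_derivative (\<lambda>v. G z \<bullet> v)) (at z)" "continuous_on UNIV G"
    "\<And>z. z \<in> K \<Longrightarrow> \<bar>U z - u z\<bar> \<le> \<tau>" "\<And>z j. z \<in> K \<Longrightarrow> \<bar>G z \<bullet> X j z - g z $ j\<bar> \<le> \<tau>"
proof (cases "K = {}")
  case True
  then show ?thesis using that[of "\<lambda>_. 0" "\<lambda>_. 0"] by simp
next
  case False
  then obtain z0 where z0: "z0 \<in> K" by blast
  let ?I = "integral (cbox a b)"
  have Q: "compact (cbox a b)" by simp
  have uc: "continuous_on (cbox a b) u" and gc: "continuous_on (cbox a b) g"
    using u g \<Omega>(2) continuous_on_subset unfolding continuous_hgrad_def by blast+
  have "\<exists>L. L \<ge> 0 \<and> (\<forall>y\<in>cbox a b. \<forall>z\<in>cbox a b. norm (X j y - X j z) \<le> L * norm (y - z))" for j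
    using C1_lipschitz_on_cbox[OF X \<Omega>(2), of j] by metis
  then obtain L' where L': "\<And>j. L' j \<ge> 0"
    "\<And>j y z. y \<in> cbox a b \<Longrightarrow> z \<in> cbox a b \<Longrightarrow> norm (X j y - X j z) \<le> L' j * norm (y - z)" by metis
  have "\<exists>D>0. \<forall>y\<in>cbox a b. \<bar>divergence (X j) y\<bar> \<le> D" for j
  proof -
    have "bounded (divergence (X j) ` cbox a b)"
      using continuous_on_subset[OF continuous_on_divergence[OF X] \<Omega>(2)]
      by (intro compact_imp_bounded compact_continuous_image Q)
    then show ?thesis unfolding bounded_pos by auto
  qed
  then obtain D' where D': "\<And>j. D' j > 0" "\<And>j y. y \<in> cbox a b \<Longrightarrow> \<bar>divergence (X j) y\<bar> \<le> D' j" by metis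
  \<comment> \<open>one constant dominating the commutator bounds of all fields; the summand 1 makes it positive\<close>
  define C where "C = (\<Sum>j\<in>UNIV. L' j * CARD('n) + D' j) + 1"
  have Cj: "L' j * CARD('n) + D' j \<le> C" for j
    unfolding C_def using L' D' member_le_sum[of j UNIV "\<lambda>j. L' j * CARD('n) + D' j"]
    by (simp add: add_increasing2 less_imp_le)
  have C1: "C \<ge> 1" unfolding C_def using L' D' by (simp add: sum_nonneg less_imp_le)
  define w where "w = \<tau> / (2 * C)"
  have w: "w > 0" "w * C = \<tau> / 2" "w \<le> \<tau>" using C1 \<tau> by (auto simp: w_def field_simps)
  obtain d1 where d1: "d1 > 0" "\<And>y z. y \<in> cbox a b \<Longrightarrow> z \<in> cbox a b \<Longrightarrow> dist y z < d1 \<Longrightarrow> norm (u y - u z) \<le> w"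
    using compact_uniform_modulus[OF Q uc w(1)] by metis
  obtain d2 where d2: "d2 > 0" "\<And>y z. y \<in> cbox a b \<Longrightarrow> z \<in> cbox a b \<Longrightarrow> dist y z < d2 \<Longrightarrow> norm (g y - g z) \<le> \<tau> / 2"
    using compact_uniform_modulus[OF Q gc half_gt_zero[OF \<tau>]] by metis
  obtain d3 where d3: "d3 > 0" "(\<Union>x\<in>K. cball x d3) \<subseteq> box a b"
    using compact_subset_open_imp_cball_epsilon_subset[OF K(1) open_box K(2)] by metis
  define e where "e = min d3 (min d1 d2 / 2)"
  have e: "e > 0" "e \<le> d3" "e < d1" "e < d2" using d1(1) d2(1) d3(1) by (auto simp: e_def)
  have ball: "cball z e \<subseteq> box a b" if "z \<in> K" for z
    using d3(2) e(2) that subset_cball[of e d3 z] by blast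
  have ball': "cball z e \<subseteq> cbox a b" if "z \<in> K" for z
    using ball[OF that] box_subset_cbox[of a b] by order
  define N where "N = ?I (bump e z0)"
  have N: "N > 0" unfolding N_def using integral_bump_pos[OF e(1)] z0 K(2) by blast
  have Nz: "?I (bump e z) = N" if "z \<in> K" for z
    unfolding N_def using integral_bump_eq[OF e(1) ball'[OF that] ball'[OF z0]] .
  define U where "U z = ?I (\<lambda>y. u y * bump e z y) / N" for z
  define G where "G z = (1 / N) *\<^sub>R ?I (\<lambda>y. - u y *\<^sub>R bump_grad e z y)" for z
  \<comment> \<open>averaging against the bump moves a value by at most the oscillation on its support\<close>
  have avg: "\<bar>?I (\<lambda>y. f y * bump e z y) - f z * N\<bar> \<le> \<epsilon> * N"
    if z: "z \<in> K" and f: "continuous_on (cbox a b) f"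
      and osc: "\<And>y. y \<in> cball z e \<Longrightarrow> \<bar>f y - f z\<bar> \<le> \<epsilon>" for f z and \<epsilon> :: real
  proof -
    have "norm (?I (\<lambda>y. (f y - f z) * bump e z y)) \<le> ?I (\<lambda>y. \<epsilon> * bump e z y)"
    proof (rule integral_norm_bound_integral)
      fix y
      show "norm ((f y - f z) * bump e z y) \<le> \<epsilon> * bump e z y"
        using osc[of y] bump_nonneg[of e z y] bump_eq_0[of y z e] e(1)
        by (cases "y \<in> cball z e") (auto simp: abs_mult intro: mult_right_mono simp del: mem_cball)
    qed (intro integrable_continuous continuous_intros f)+
    moreover have "?I (\<lambda>y. (f y - f z) * bump e z y) = ?I (\<lambda>y. f y * bump e z y) - ?I (\<lambda>y. f z * bump e z y)"
      unfolding left_diff_distrib by (intro integral_diff integrable_continuous continuous_intros f)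
    ultimately show ?thesis using Nz[OF z] by simp
  qed
  show ?thesis
  proof (rule that)
    show "(U has_derivative (\<lambda>v. G z \<bullet> v)) (at z)" for z
      using has_derivative_mult_right[OF mollification_has_derivative(1)[OF uc, of e z], of "1 / N"]
      by (simp add: U_def[abs_def] G_def)
    show "continuous_on UNIV G"
      unfolding G_def by (intro continuous_intros mollification_has_derivative(2)[OF uc])
  next
    fix z assume z: "z \<in> K"
    have zQ: "z \<in> cbox a b" using z K(2) box_subset_cbox[of a b] by blast
    have "\<bar>?I (\<lambda>y. u y * bump e z y) - u z * N\<bar> \<le> w * N"
      using d1(2)[OF _ zQ] ball'[OF z] e(3) by (intro avg[OF z uc]) (force simp: dist_commute)
    then have "\<bar>U z - u z\<bar> \<le> w"
      using N unfolding U_def by (simp add: abs_le_iff field_simps)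
    then show "\<bar>U z - u z\<bar> \<le> \<tau>" using w(3) by simp
  next
    fix z j assume z: "z \<in> K"
    have zQ: "z \<in> cbox a b" using z K(2) box_subset_cbox[of a b] by blast
    have gj: "continuous_on (cbox a b) (\<lambda>y. g y $ j)" by (intro continuous_on_component gc)
    have "\<bar>?I (\<lambda>y. u y * (bump_grad e z y \<bullet> X j z)) + ?I (\<lambda>y. g y $ j * bump e z y)\<bar>
        \<le> w * (L' j * CARD('n) + D' j) * ?I (bump e z)"
    proof (rule mollifier_commutator_bound[OF \<Omega> X uc gj e(1) ball[OF z]])
      show "?I (\<lambda>y. u y * (bump_grad e z y \<bullet> X j y + bump e z y * divergence (X j) y)) =
          - ?I (\<lambda>y. g y $ j * bump e z y)"
        by (rule hgrad_tested_on_bump[OF \<Omega> X u g e(1) ball[OF z]])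
      show "\<bar>u y - u z\<bar> \<le> w" if "y \<in> cball z e" for y
        using d1(2)[OF _ zQ, of y] ball'[OF z] e(3) that by (force simp: dist_commute)
    qed (use L'(2)[OF _ zQ] D'(2) ball'[OF z] in blast)+
    also have "\<dots> \<le> w * C * N"
      using Cj[of j] w(1) N Nz[OF z] by (simp add: mult_left_mono mult_right_mono)
    finally have 1: "\<bar>?I (\<lambda>y. u y * (bump_grad e z y \<bullet> X j z)) + ?I (\<lambda>y. g y $ j * bump e z y)\<bar> \<le> \<tau> / 2 * N"
      by (simp add: w(2))
    have "\<bar>g y $ j - g z $ j\<bar> \<le> \<tau> / 2" if "y \<in> cball z e" for y
    proof -
      have "norm (g y - g z) \<le> \<tau> / 2"
        using d2(2)[OF _ zQ, of y] ball'[OF z] e(4) that by (force simp: dist_commute)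
      then show ?thesis using component_le_norm_cart[of "g y - g z" j] by simp
    qed
    then have 2: "\<bar>?I (\<lambda>y. g y $ j * bump e z y) - g z $ j * N\<bar> \<le> \<tau> / 2 * N"
      by (rule avg[OF z gj])
    have "?I (\<lambda>y. - u y *\<^sub>R bump_grad e z y) \<bullet> X j z = ?I (\<lambda>y. - u y *\<^sub>R bump_grad e z y \<bullet> X j z)"
      by (subst integral_linear[OF _ bounded_linear_inner_left, symmetric])
         (auto simp: o_def intro!: integrable_continuous continuous_intros uc)
    then have "G z \<bullet> X j z * N = - ?I (\<lambda>y. u y * (bump_grad e z y \<bullet> X j z))"
      using N by (simp add: G_def)
    then have "\<bar>(G z \<bullet> X j z - g z $ j) * N\<bar> \<le> \<tau> * N"
      using 1 2 unfolding left_diff_distrib abs_le_iff by linarith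
    then show "\<bar>G z \<bullet> X j z - g z $ j\<bar> \<le> \<tau>" using N by (simp add: abs_mult)
  qed
qed

section \<open>Absolutely continuous curves\<close>

lemma absolutely_continuous_onD:
  assumes "absolutely_continuous_on a b \<gamma>" "\<epsilon> > 0"
  obtains \<delta> where "\<delta> > 0" "\<And>D S. \<lbrakk>D division_of S; S \<subseteq> {a..b}; (\<Sum>k\<in>D. Sup k - Inf k) < \<delta>\<rbrakk> \<Longrightarrow>
        (\<Sum>k\<in>D. norm (\<gamma> (Sup k) - \<gamma> (Inf k))) < \<epsilon>"
  using assms unfolding absolutely_continuous_on_def by meson

lemma absolutely_continuous_on_subinterval:
  assumes "absolutely_continuous_on a b \<gamma>" "a \<le> c" "d \<le> b"
  shows "absolutely_continuous_on c d \<gamma>"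
proof -
  have "{c..d} \<subseteq> {a..b}" using assms by auto
  then show ?thesis using assms(1) unfolding absolutely_continuous_on_def
    by (meson order_trans)
qed

lemma division_interval_endpoints:
  fixes K :: "real set"
  assumes "D division_of S" "K \<in> D"
  shows "K = {Inf K..Sup K}" "Inf K \<le> Sup K"
proof -
  obtain a b where "K = cbox a b" "K \<noteq> {}"
    using division_ofD(3,4)[OF assms(1)] assms(2) by metis
  then show "K = {Inf K..Sup K}" "Inf K \<le> Sup K" by auto
qed

lemma absolutely_continuous_on_lipschitz_compose:
  assumes ac: "absolutely_continuous_on a b \<gamma>"
    and lip: "\<And>s t. s \<in> {a..b} \<Longrightarrow> t \<in> {a..b} \<Longrightarrow> norm (f (\<gamma> s) - f (\<gamma> t)) \<le> K * norm (\<gamma> s - \<gamma> t)"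
  shows "absolutely_continuous_on a b (\<lambda>t. f (\<gamma> t))"
  unfolding absolutely_continuous_on_def
proof (intro allI impI)
  fix \<epsilon> :: real assume "\<epsilon> > 0"
  \<comment> \<open>\<open>K\<close> may be zero or negative (for constant curves), so it is enlarged before dividing by it\<close>
  define K' where "K' = \<bar>K\<bar> + 1"
  have K': "K' > 0" "K \<le> K'" by (auto simp: K'_def)
  obtain \<delta> where \<delta>: "\<delta> > 0" "\<And>D S. \<lbrakk>D division_of S; S \<subseteq> {a..b}; (\<Sum>k\<in>D. Sup k - Inf k) < \<delta>\<rbrakk> \<Longrightarrow>
        (\<Sum>k\<in>D. norm (\<gamma> (Sup k) - \<gamma> (Inf k))) < \<epsilon> / K'"
    using absolutely_continuous_onD[OF ac, of "\<epsilon> / K'"] \<open>\<epsilon> > 0\<close> K' by auto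
  show "\<exists>\<delta>>0. \<forall>D S. D division_of S \<and> S \<subseteq> {a..b} \<and> (\<Sum>k\<in>D. Sup k - Inf k) < \<delta> \<longrightarrow>
        (\<Sum>k\<in>D. norm (f (\<gamma> (Sup k)) - f (\<gamma> (Inf k)))) < \<epsilon>"
  proof (intro exI[of _ \<delta>] conjI allI impI \<delta>(1))
    fix D S assume D: "D division_of S \<and> S \<subseteq> {a..b} \<and> (\<Sum>k\<in>D. Sup k - Inf k) < \<delta>"
    have "(\<Sum>k\<in>D. norm (f (\<gamma> (Sup k)) - f (\<gamma> (Inf k)))) \<le> (\<Sum>k\<in>D. K' * norm (\<gamma> (Sup k) - \<gamma> (Inf k)))"
    proof (rule sum_mono)
      fix k assume "k \<in> D"
      then have "k = {Inf k..Sup k}" "Inf k \<le> Sup k" "k \<subseteq> {a..b}"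
        using D division_interval_endpoints[of D S k] by (auto dest: division_ofD(2))
      then have "Inf k \<in> {a..b}" "Sup k \<in> {a..b}" by (metis atLeastAtMost_iff order_refl subsetD)+
      then have "norm (f (\<gamma> (Sup k)) - f (\<gamma> (Inf k))) \<le> K * norm (\<gamma> (Sup k) - \<gamma> (Inf k))"
        using lip by blast
      also have "\<dots> \<le> K' * norm (\<gamma> (Sup k) - \<gamma> (Inf k))" by (intro mult_right_mono K') simp
      finally show "norm (f (\<gamma> (Sup k)) - f (\<gamma> (Inf k))) \<le> K' * norm (\<gamma> (Sup k) - \<gamma> (Inf k))" .
    qed
    also have "\<dots> = K' * (\<Sum>k\<in>D. norm (\<gamma> (Sup k) - \<gamma> (Inf k)))" by (simp add: sum_distrib_left)
    also have "\<dots> < K' * (\<epsilon> / K')" using \<delta>(2) D K' by (intro mult_strict_left_mono) auto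
    finally show "(\<Sum>k\<in>D. norm (f (\<gamma> (Sup k)) - f (\<gamma> (Inf k)))) < \<epsilon>" using K' by simp
  qed
qed

lemma absolutely_continuous_on_imp_continuous_on:
  assumes ac: "absolutely_continuous_on a b \<gamma>"
  shows "continuous_on {a..b} \<gamma>"
  unfolding continuous_on_iff
proof (intro ballI allI impI)
  fix s and \<epsilon> :: real assume s: "s \<in> {a..b}" and "\<epsilon> > 0"
  obtain \<delta> where \<delta>: "\<delta> > 0" "\<And>D S. \<lbrakk>D division_of S; S \<subseteq> {a..b}; (\<Sum>k\<in>D. Sup k - Inf k) < \<delta>\<rbrakk> \<Longrightarrow>
        (\<Sum>k\<in>D. norm (\<gamma> (Sup k) - \<gamma> (Inf k))) < \<epsilon>"
    using absolutely_continuous_onD[OF ac \<open>\<epsilon> > 0\<close>] by metis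
  have *: "norm (\<gamma> q - \<gamma> p) < \<epsilon>" if "p \<le> q" "p \<in> {a..b}" "q \<in> {a..b}" "q - p < \<delta>" for p q
    using \<delta>(2)[of "{{p..q}}" "{p..q}"] that division_of_self[of p q] by auto
  show "\<exists>d>0. \<forall>t\<in>{a..b}. dist t s < d \<longrightarrow> dist (\<gamma> t) (\<gamma> s) < \<epsilon>"
  proof (intro exI[of _ \<delta>] conjI ballI impI \<delta>(1))
    fix t assume "t \<in> {a..b}" "dist t s < \<delta>"
    then show "dist (\<gamma> t) (\<gamma> s) < \<epsilon>"
      using *[of s t] *[of t s] s by (cases "s \<le> t") (auto simp: dist_norm norm_minus_commute)
  qed
qed

text \<open>
  The straddle lemma: the tag lies between the two end points, so the errors at both sides are
  bounded by a multiple of the length of the whole interval.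
\<close>

lemma straddle_norm_bound:
  fixes h :: "real \<Rightarrow> 'a::real_normed_vector"
  assumes "(h has_vector_derivative D) (at t within S)" "norm D \<le> B" "e > 0"
  obtains d where "d > 0" "\<And>p q. \<lbrakk>p \<in> S; q \<in> S; p \<le> t; t \<le> q; {p..q} \<subseteq> ball t d\<rbrakk> \<Longrightarrow>
      norm (h q - h p) \<le> (B + e) * (q - p)"
proof -
  obtain d where d: "d > 0" "\<And>y. y \<in> S \<Longrightarrow> norm (y - t) < d \<Longrightarrow>
      norm (h y - h t - (y - t) *\<^sub>R D) \<le> e * norm (y - t)"
    using assms(1,3) unfolding has_vector_derivative_def has_derivative_within_alt by metis
  have *: "norm (h y - h t) \<le> (B + e) * \<bar>y - t\<bar>" if "y \<in> S" "\<bar>y - t\<bar> < d" for y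
  proof -
    have "norm (h y - h t) \<le> norm (h y - h t - (y - t) *\<^sub>R D) + norm ((y - t) *\<^sub>R D)"
      by (metis diff_add_cancel norm_triangle_ineq)
    also have "\<dots> \<le> e * \<bar>y - t\<bar> + \<bar>y - t\<bar> * B"
      using d(2)[of y] that assms(2) by (intro add_mono) (auto intro: mult_left_mono)
    finally show ?thesis by (simp add: algebra_simps)
  qed
  show ?thesis
  proof (rule that[OF d(1)])
    fix p q assume pq: "p \<in> S" "q \<in> S" "p \<le> t" "t \<le> q" "{p..q} \<subseteq> ball t d"
    then have "p \<in> ball t d" "q \<in> ball t d" by (meson atLeastAtMost_iff order_refl order_trans subsetD)+
    then have "norm (h q - h t) \<le> (B + e) * (q - t)" "norm (h p - h t) \<le> (B + e) * (t - p)"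
      using *[of p] *[of q] pq by (auto simp: dist_real_def)
    then show "norm (h q - h p) \<le> (B + e) * (q - p)"
      using norm_triangle_ineq4[of "h q - h t" "h p - h t"] by (simp add: algebra_simps)
  qed
qed

text \<open>
  Choose a gauge that is fine enough for the straddle lemma at points of differentiability,
  and that keeps intervals tagged in the exceptional null set inside an open set of small
  measure. On a fine tagged division the increments over the first kind of intervals sum to at
  most \<open>(B + e) T\<close>, those over the second kind are small by absolute continuity.
\<close>

lemma absolutely_continuous_norm_increment_le:
  fixes h :: "real \<Rightarrow> 'a::real_normed_vector"
  assumes T: "0 \<le> T" and B: "0 \<le> B" and ac: "absolutely_continuous_on 0 T h"
    and der: "AE t in lebesgue_on {0..T}.
        \<exists>D. (h has_vector_derivative D) (at t within {0..T}) \<and> norm D \<le> B"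
  shows "norm (h T - h 0) \<le> B * T"
proof (rule field_le_epsilon)
  fix \<epsilon> :: real assume "\<epsilon> > 0"
  \<comment> \<open>the slack \<open>\<epsilon>\<close> is shared by the straddle errors and the exceptional intervals\<close>
  define e where "e = \<epsilon> / (2 * (T + 1))"
  have e: "e > 0" "e * T \<le> \<epsilon> / 2" using T \<open>\<epsilon> > 0\<close> by (auto simp: e_def field_simps)
  obtain \<delta> where \<delta>: "\<delta> > 0" "\<And>D S. \<lbrakk>D division_of S; S \<subseteq> {0..T}; (\<Sum>k\<in>D. Sup k - Inf k) < \<delta>\<rbrakk> \<Longrightarrow>
        (\<Sum>k\<in>D. norm (h (Sup k) - h (Inf k))) < \<epsilon> / 2"
    using absolutely_continuous_onD[OF ac, of "\<epsilon> / 2"] \<open>\<epsilon> > 0\<close> by auto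
  define good where "good t \<longleftrightarrow> (\<exists>D. (h has_vector_derivative D) (at t within {0..T}) \<and> norm D \<le> B)" for t
  define N where "N = {t \<in> {0..T}. \<not> good t}"
  have "AE t in lebesgue. t \<in> {0..T} \<longrightarrow> good t"
    using der by (subst (asm) AE_restrict_space_iff) (auto simp: good_def)
  then have "N \<in> null_sets lebesgue"
    unfolding N_def by (simp add: completion.AE_iff_null_sets)
  then have N: "N \<in> null_sets lebesgue" "N \<in> sets lebesgue" by auto
  obtain U where U: "open U" "N \<subseteq> U" "U - N \<in> lmeasurable" "emeasure lebesgue (U - N) < ennreal \<delta>"
    using sets_lebesgue_outer_open[OF N(2) \<delta>(1)] by metis
  have "U \<in> sets lebesgue" using U(1) by (simp add: borel_open)
  moreover have eU: "emeasure lebesgue U < ennreal \<delta>"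
    using U(4) emeasure_Diff_null_set[OF N(1) \<open>U \<in> sets lebesgue\<close>] by simp
  ultimately have U': "U \<in> lmeasurable" by (auto simp: fmeasurable_def less_top[symmetric] intro: order.strict_trans)
  then have mU: "measure lebesgue U < \<delta>"
    using eU \<delta>(1) by (simp add: emeasure_eq_measure2 ennreal_less_iff)
  have "\<exists>d>0. (t \<in> N \<longrightarrow> ball t d \<subseteq> U) \<and> (t \<in> {0..T} - N \<longrightarrow>
      (\<forall>p q. p \<in> {0..T} \<longrightarrow> q \<in> {0..T} \<longrightarrow> p \<le> t \<longrightarrow> t \<le> q \<longrightarrow> {p..q} \<subseteq> ball t d \<longrightarrow>
      norm (h q - h p) \<le> (B + e) * (q - p)))" for t
  proof (cases "t \<in> N")
    case True
    then show ?thesis using U(1,2) open_contains_ball by (metis DiffD2 subsetD)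
  next
    case False
    show ?thesis
    proof (cases "t \<in> {0..T}")
      case True
      with False obtain D where "(h has_vector_derivative D) (at t within {0..T})" "norm D \<le> B"
        by (auto simp: N_def good_def)
      from straddle_norm_bound[OF this e(1)] show ?thesis using False by metis
    qed (use False in \<open>auto intro!: exI[of _ 1]\<close>)
  qed
  then obtain d where d: "\<And>t. d t > 0" "\<And>t. t \<in> N \<Longrightarrow> ball t (d t) \<subseteq> U"
    "\<And>t p q. \<lbrakk>t \<in> {0..T}; t \<notin> N; p \<in> {0..T}; q \<in> {0..T}; p \<le> t; t \<le> q; {p..q} \<subseteq> ball t (d t)\<rbrakk> \<Longrightarrow>
      norm (h q - h p) \<le> (B + e) * (q - p)"
    by (metis Diff_iff)
  have "gauge (\<lambda>t. ball t (d t))" using d(1) by (intro gauge_ball_dependent) auto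
  then obtain p where p: "p tagged_division_of {0..T}" and fine: "(\<lambda>t. ball t (d t)) fine p"
    using fine_division_exists_real by blast
  note finp = tagged_division_of_finite[OF p]
  have ends: "k = {Inf k..Sup k} \<and> Inf k \<le> t \<and> t \<le> Sup k \<and> Inf k \<in> {0..T} \<and> Sup k \<in> {0..T} \<and> k \<subseteq> ball t (d t)"
    if tk: "(t, k) \<in> p" for t k
  proof -
    have "k \<in> snd ` p" using tk by force
    then have *: "k = {Inf k..Sup k}" "Inf k \<le> Sup k"
      using division_interval_endpoints division_of_tagged_division[OF p] by blast+
    have "t \<in> k" "k \<subseteq> {0..T}" using tagged_division_ofD(2,3)[OF p tk] by auto
    moreover have "k \<subseteq> ball t (d t)" using fine tk by (auto simp: fine_def)
    ultimately show ?thesis using * by (metis atLeastAtMost_iff order_refl subsetD)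
  qed
  define p1 where "p1 = p \<inter> {tk. fst tk \<in> N}"
  define p2 where "p2 = p - p1"
  have fin: "finite p1" "finite p2" and disj: "p1 \<inter> p2 = {}" "p = p1 \<union> p2"
    using finp by (auto simp: p1_def p2_def)
  have tele: "(\<Sum>(t, k)\<in>p. g (Sup k) - g (Inf k)) = g T - g 0" for g :: "real \<Rightarrow> 'b::real_normed_vector"
    using additive_tagged_division_1[OF T p] by simp
  have "norm (h T - h 0) = norm (\<Sum>(t, k)\<in>p. h (Sup k) - h (Inf k))" by (simp add: tele)
  also have "\<dots> \<le> (\<Sum>(t, k)\<in>p. norm (h (Sup k) - h (Inf k)))"
    by (rule sum_norm_le) auto
  also have "\<dots> = (\<Sum>(t, k)\<in>p1. norm (h (Sup k) - h (Inf k))) + (\<Sum>(t, k)\<in>p2. norm (h (Sup k) - h (Inf k)))"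
    unfolding disj(2) by (rule sum.union_disjoint[OF fin disj(1)])
  also have "(\<Sum>(t, k)\<in>p1. norm (h (Sup k) - h (Inf k))) < \<epsilon> / 2"
  proof -
    define S where "S = \<Union>(snd ` p1)"
    have part: "p1 tagged_partial_division_of {0..T}"
      using p unfolding p1_def tagged_division_of_def by (blast intro: tagged_partial_division_subset)
    have tag: "p1 tagged_division_of S"
    proof -
      have "S = (\<Union>{K. \<exists>x. (x, K) \<in> p1})" unfolding S_def by force
      moreover have "K \<subseteq> S" if "(x, K) \<in> p1" for x K using that unfolding S_def by force
      then have "p1 tagged_partial_division_of S"
        using part unfolding tagged_partial_division_of_def by meson
      ultimately show ?thesis by (simp add: tagged_division_of_def)
    qed
    have div: "snd ` p1 division_of S" using division_of_tagged_division[OF tag] .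
    have S: "S \<subseteq> {0..T}" "S \<subseteq> U"
    proof -
      show "S \<subseteq> {0..T}" unfolding S_def p1_def using tagged_division_ofD(3)[OF p] by fastforce
      show "S \<subseteq> U" unfolding S_def p1_def using ends d(2) by fastforce
    qed
    have "(\<Sum>k\<in>snd ` p1. Sup k - Inf k) = (\<Sum>k\<in>snd ` p1. measure lebesgue k)"
    proof (rule sum.cong[OF refl])
      fix k assume "k \<in> snd ` p1"
      note k = division_interval_endpoints[OF div this]
      have "measure lebesgue {Inf k..Sup k} = Sup k - Inf k" using k(2) by simp
      then show "Sup k - Inf k = measure lebesgue k" by (subst (3) k(1)) (rule sym)
    qed
    also have "\<dots> = measure lebesgue S" using content_division[OF div] by simp
    also have "\<dots> \<le> measure lebesgue U"
      using S U' lmeasurable_division[OF div] by (intro measure_mono_fmeasurable) auto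
    also have "\<dots> < \<delta>" by (rule mU)
    finally have "(\<Sum>k\<in>snd ` p1. norm (h (Sup k) - h (Inf k))) < \<epsilon> / 2"
      using \<delta>(2)[OF div S(1)] by simp
    moreover have "(\<Sum>(t, k)\<in>p1. norm (h (Sup k) - h (Inf k))) = (\<Sum>k\<in>snd ` p1. norm (h (Sup k) - h (Inf k)))"
    proof (subst sum.reindex_nontrivial[OF fin(1)])
      fix a b assume ab: "a \<in> p1" "b \<in> p1" "a \<noteq> b" "snd a = snd b"
      \<comment> \<open>Two tags may share an interval, but only a degenerate one.\<close>
      have "interior (snd a) \<inter> interior (snd b) = {}"
        using tagged_division_ofD(5)[OF tag, of "fst a" "snd a" "fst b" "snd b"] ab(1-3)
        by (metis prod.collapse)
      then have "interior (snd a) = {}" using ab by simp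
      moreover have "snd a = {Inf (snd a)..Sup (snd a)}" "Inf (snd a) \<le> Sup (snd a)"
        using division_interval_endpoints[OF div, of "snd a"] ab by blast+
      ultimately have "Inf (snd a) = Sup (snd a)"
        by (metis greaterThanLessThan_empty_iff interior_atLeastAtMost_real order_antisym)
      then show "norm (h (Sup (snd a)) - h (Inf (snd a))) = 0" by simp
    qed (simp add: case_prod_unfold)
    ultimately show ?thesis by simp
  qed
  also have "(\<Sum>(t, k)\<in>p2. norm (h (Sup k) - h (Inf k))) \<le> (\<Sum>(t, k)\<in>p2. (B + e) * (Sup k - Inf k))"
  proof (rule sum_mono, clarify)
    fix t k assume tk: "(t, k) \<in> p2"
    then have "(t, k) \<in> p" "t \<notin> N" by (auto simp: p2_def p1_def)
    moreover have "t \<in> {0..T}" using tag_in_interval[OF p \<open>(t, k) \<in> p\<close>] .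
    ultimately show "norm (h (Sup k) - h (Inf k)) \<le> (B + e) * (Sup k - Inf k)"
      using ends[of t k] d(3)[of t "Inf k" "Sup k"] by metis
  qed
  also have "\<dots> \<le> (\<Sum>(t, k)\<in>p. (B + e) * (Sup k - Inf k))"
    by (rule sum_mono2) (use finp disj ends B e in \<open>force+\<close>)
  also have "\<dots> = (B + e) * (\<Sum>(t, k)\<in>p. Sup k - Inf k)"
    by (simp add: sum_distrib_left case_prod_unfold)
  also have "\<dots> = (B + e) * T" using tele[of "\<lambda>x. x"] by simp
  finally show "norm (h T - h 0) \<le> B * T + \<epsilon>" using e(2) by (simp add: algebra_simps)
qed

section \<open>Sub-unit curves\<close>

text \<open>
  Along the curve \<open>f\<close> has derivative \<open>\<Sum> a\<^sub>j
  f'(X\<^sub>j)\<close> with \<open>|a\<^sub>j| \<le> 1\<close>, so only the horizontal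
  derivatives of \<open>f\<close> enter the bound. The bound \<open>M\<close> on the full
  derivative makes \<open>f \<circ> \<gamma>\<close> absolutely continuous. Only an initial
  part of the curve need lie in \<open>B\<close>, so that the lemma applies up to an exit
  time.
\<close>

lemma subunit_curve_increment_le:
  fixes X :: "'m::finite \<Rightarrow> real^'n::finite \<Rightarrow> real^'n" and f :: "real^'n \<Rightarrow> 'b::real_normed_vector" and T s \<eta> M :: real
  assumes \<gamma>: "subunit_curve \<Omega> X T \<gamma>" and s: "0 \<le> s" "s \<le> T"
    and B: "convex B" "\<gamma> ` {0..s} \<subseteq> B"
    and f: "\<And>z. z \<in> B \<Longrightarrow> (f has_derivative f' z) (at z)"
    and M: "\<And>z. z \<in> B \<Longrightarrow> onorm (f' z) \<le> M"
    and \<eta>: "0 \<le> \<eta>" "\<And>z j. z \<in> B \<Longrightarrow> norm (f' z (X j z)) \<le> \<eta>"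
  shows "norm (f (\<gamma> s) - f (\<gamma> 0)) \<le> CARD('m) * \<eta> * s"
proof -
  have "0 \<le> CARD('m) * \<eta>" using \<eta>(1) by simp
  have ac: "absolutely_continuous_on 0 s (\<lambda>t. f (\<gamma> t))"
  proof (rule absolutely_continuous_on_lipschitz_compose[where f = f and \<gamma> = \<gamma> and K = M])
    show "absolutely_continuous_on 0 s \<gamma>"
      using \<gamma> s absolutely_continuous_on_subinterval unfolding subunit_curve_def by blast
    show "norm (f (\<gamma> p) - f (\<gamma> q)) \<le> M * norm (\<gamma> p - \<gamma> q)" if "p \<in> {0..s}" "q \<in> {0..s}" for p q
      using that B f M by (intro differentiable_bound[OF B(1)]) (auto intro: has_derivative_at_withinI)
  qed
  obtain a :: "real \<Rightarrow> real^'m" where "AE t in lebesgue_on {0..T}. (\<Sum>j\<in>UNIV. (a t $ j)\<^sup>2) \<le> 1 \<and>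
       (\<gamma> has_vector_derivative (\<Sum>j\<in>UNIV. a t $ j *\<^sub>R X j (\<gamma> t))) (at t within {0..T})"
    using \<gamma> unfolding subunit_curve_def by blast
  then have "AE t in lebesgue. t \<in> {0..T} \<longrightarrow> (\<Sum>j\<in>UNIV. (a t $ j)\<^sup>2) \<le> 1 \<and>
       (\<gamma> has_vector_derivative (\<Sum>j\<in>UNIV. a t $ j *\<^sub>R X j (\<gamma> t))) (at t within {0..T})"
    by (subst (asm) AE_restrict_space_iff) auto
  then have "AE t in lebesgue. t \<in> {0..s} \<longrightarrow>
      (\<exists>D. ((\<lambda>t. f (\<gamma> t)) has_vector_derivative D) (at t within {0..s}) \<and> norm D \<le> CARD('m) * \<eta>)"
  proof (rule AE_mp, intro AE_I2 impI)
    fix t assume t: "t \<in> {0..s}"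
      and "t \<in> {0..T} \<longrightarrow> (\<Sum>j\<in>UNIV. (a t $ j)\<^sup>2) \<le> 1 \<and>
       (\<gamma> has_vector_derivative (\<Sum>j\<in>UNIV. a t $ j *\<^sub>R X j (\<gamma> t))) (at t within {0..T})"
    then have a: "(\<Sum>j\<in>UNIV. (a t $ j)\<^sup>2) \<le> 1"
      and der: "(\<gamma> has_vector_derivative (\<Sum>j\<in>UNIV. a t $ j *\<^sub>R X j (\<gamma> t))) (at t within {0..T})"
      using s by auto
    let ?V = "\<Sum>j\<in>UNIV. a t $ j *\<^sub>R X j (\<gamma> t)"
    have z: "\<gamma> t \<in> B" using t B(2) by blast
    note lin = has_derivative_bounded_linear[OF f[OF z]]
    have "(\<gamma> has_derivative (\<lambda>r. r *\<^sub>R ?V)) (at t within {0..s})"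
      using has_vector_derivative_within_subset[OF der, of "{0..s}"] s
      by (auto simp: has_vector_derivative_def)
    from has_derivative_compose[OF this f[OF z]]
    have "((\<lambda>t. f (\<gamma> t)) has_derivative (\<lambda>r. f' (\<gamma> t) (r *\<^sub>R ?V))) (at t within {0..s})" .
    then have 1: "((\<lambda>t. f (\<gamma> t)) has_vector_derivative f' (\<gamma> t) ?V) (at t within {0..s})"
      unfolding has_vector_derivative_def using bounded_linear.linear[OF lin] by (simp add: linear_scale)
    have summand: "norm (a t $ j *\<^sub>R f' (\<gamma> t) (X j (\<gamma> t))) \<le> 1 * \<eta>" for j
    proof -
      have "(a t $ j)\<^sup>2 \<le> (\<Sum>j\<in>UNIV. (a t $ j)\<^sup>2)" by (rule member_le_sum) auto
      then have "\<bar>a t $ j\<bar> \<le> 1" using a abs_square_le_1 order_trans by blast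
      then show ?thesis unfolding norm_scaleR using \<eta>(2)[OF z] by (intro mult_mono) auto
    qed
    have "f' (\<gamma> t) ?V = (\<Sum>j\<in>UNIV. a t $ j *\<^sub>R f' (\<gamma> t) (X j (\<gamma> t)))"
      using bounded_linear.linear[OF lin] by (simp add: linear_sum linear_scale)
    then have "norm (f' (\<gamma> t) ?V) \<le> (\<Sum>j\<in>(UNIV :: 'm set). 1 * \<eta>)"
      by (simp only:) (rule sum_norm_le, rule summand)
    then show "\<exists>D. ((\<lambda>t. f (\<gamma> t)) has_vector_derivative D) (at t within {0..s}) \<and> norm D \<le> CARD('m) * \<eta>"
      using 1 by auto
  qed
  then have "AE t in lebesgue_on {0..s}.
      \<exists>D. ((\<lambda>t. f (\<gamma> t)) has_vector_derivative D) (at t within {0..s}) \<and> norm D \<le> CARD('m) * \<eta>"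
    by (subst AE_restrict_space_iff) auto
  with s(1) \<open>0 \<le> CARD('m) * \<eta>\<close> ac show ?thesis
    by (rule absolutely_continuous_norm_increment_le)
qed

text \<open>
  Before the first time at which the curve reaches distance \<open>r\<close>, its speed is at
  most \<open>CARD('m) * M\<close>, so its distance from \<open>x\<close> is at most
  \<open>CARD('m) * M * T < r\<close>; by continuity this persists at that time.
\<close>

lemma subunit_curve_stays_in_cball:
  fixes X :: "'m::finite \<Rightarrow> real^'n::finite \<Rightarrow> real^'n" and T r M :: real
  assumes \<gamma>: "subunit_curve \<Omega> X T \<gamma>" "\<gamma> 0 = x"
    and M: "0 \<le> M" "\<And>z j. z \<in> cball x r \<Longrightarrow> norm (X j z) \<le> M"
    and T: "0 \<le> T" "CARD('m) * M * T < r"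
  shows "\<gamma> ` {0..T} \<subseteq> cball x r"
proof (rule ccontr)
  assume "\<not> ?thesis"
  then obtain t where t: "t \<in> {0..T}" "r < dist x (\<gamma> t)"
    unfolding image_subset_iff mem_cball by (meson not_le)
  define S where "S = {s \<in> {0..T}. r \<le> dist x (\<gamma> s)}"
  have cont: "continuous_on {0..T} \<gamma>"
    using \<gamma>(1) absolutely_continuous_on_imp_continuous_on unfolding subunit_curve_def by blast
  have "closed S"
    unfolding S_def by (intro continuous_on_closed_Collect_le continuous_intros cont closed_atLeastAtMost)
  moreover have "S \<noteq> {}" "bdd_below S" using t by (auto simp: S_def bdd_below_def)
  ultimately have "Inf S \<in> S" by (intro closed_contains_Inf)
  define s0 where "s0 = Inf S"
  have s0: "s0 \<in> {0..T}" "r \<le> dist x (\<gamma> s0)" using \<open>Inf S \<in> S\<close> by (auto simp: S_def s0_def)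
  have before: "dist x (\<gamma> s) < r" if "0 \<le> s" "s < s0" for s
    using that s0 cInf_lower[of s S] \<open>bdd_below S\<close> by (force simp: S_def s0_def)
  have near: "dist x (\<gamma> s) \<le> CARD('m) * M * T" if "0 \<le> s" "s < s0" for s
  proof -
    have "norm (\<gamma> s - \<gamma> 0) \<le> CARD('m) * M * s"
    proof (rule subunit_curve_increment_le[OF \<gamma>(1), where f = "\<lambda>z. z" and f' = "\<lambda>_ v. v"
          and B = "cball x r" and M = 1])
      show "\<gamma> ` {0..s} \<subseteq> cball x r" using before that by force
    qed (use that s0 M in \<open>auto simp: onorm_le\<close>)
    also have "\<dots> \<le> CARD('m) * M * T" using that s0 M(1) by (intro mult_left_mono) auto
    finally show ?thesis using \<gamma>(2) by (simp add: dist_norm norm_minus_commute)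
  qed
  have "s0 \<noteq> 0"
  proof
    assume "s0 = 0"
    then have "r \<le> 0" using s0(2) \<gamma>(2) by simp
    then show False using T M(1) by (smt (verit) mult_nonneg_nonneg of_nat_0_le_iff)
  qed
  obtain d where d: "d > 0" "\<And>s. s \<in> {0..T} \<Longrightarrow> dist s s0 < d \<Longrightarrow> dist (\<gamma> s) (\<gamma> s0) < r - CARD('m) * M * T"
    using cont s0(1) T(2) unfolding continuous_on_iff by (metis diff_gt_0_iff_gt)
  \<comment> \<open>a time just before the exit time, at which the distance bound is already known\<close>
  define s where "s = max 0 (s0 - d / 2)"
  have s: "0 \<le> s" "s < s0" "dist s s0 < d" using d(1) s0(1) \<open>s0 \<noteq> 0\<close> by (auto simp: s_def dist_real_def)
  have "dist x (\<gamma> s0) \<le> dist x (\<gamma> s) + dist (\<gamma> s) (\<gamma> s0)" by (rule dist_triangle)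
  also have "\<dots> < r" using near[OF s(1,2)] d(2)[OF _ s(3)] s s0(1) by simp
  finally show False using s0(2) by simp
qed


section \<open>The Gram matrix of the fields\<close>

lemma independent_at_combination_eq_0:
  fixes X :: "'m::finite \<Rightarrow> real^'n::finite \<Rightarrow> real^'n"
  assumes "independent_at X x" "(\<Sum>j\<in>UNIV. v $ j *\<^sub>R X j x) = 0"
  shows "v = (0 :: real^'m)"
proof -
  have inj: "inj (\<lambda>j. X j x)" and ind: "independent (range (\<lambda>j. X j x))"
    using assms(1) by (auto simp: independent_at_def)
  define c where "c w = v $ inv (\<lambda>j. X j x) w" for w
  have "(\<Sum>w\<in>range (\<lambda>j. X j x). c w *\<^sub>R w) = 0"
    using assms(2) inv_f_f[OF inj] by (simp add: sum.reindex[OF inj] c_def)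
  then have "c (X j x) = 0" for j
    using ind independentD[of "range (\<lambda>j. X j x)" "range (\<lambda>j. X j x)" c "X j x"] by simp
  then have "v $ j = 0" for j
    using inv_f_f[OF inj, of j] unfolding c_def by metis
  then show ?thesis by (simp add: vec_eq_iff)
qed

text \<open>
  If \<open>C C\<^sup>T v = 0\<close> then \<open>|C\<^sup>T v|\<^sup>2 = v \<bullet> C
  C\<^sup>T v = 0\<close>, and \<open>C\<^sup>T v\<close> is the combination of the fields
  with coefficients \<open>v\<close>.
\<close>

lemma invertible_gram_matrix:
  assumes "independent_at X x"
  shows "invertible (coeff_matrix X x ** transpose (coeff_matrix X x))"
  unfolding invertible_left_inverse matrix_left_invertible_ker
proof (intro allI impI)
  fix v assume "(coeff_matrix X x ** transpose (coeff_matrix X x)) *v v = 0"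
  then have "0 = v \<bullet> (coeff_matrix X x *v (transpose (coeff_matrix X x) *v v))"
    by (simp only: matrix_vector_mul_assoc inner_zero_right)
  also have "\<dots> = (v v* coeff_matrix X x) \<bullet> (v v* coeff_matrix X x)"
    by (simp add: dot_lmul_matrix)
  finally have "(\<Sum>j\<in>UNIV. v $ j *\<^sub>R X j x) = 0"
    by (simp add: vector_mult_coeff_matrix)
  then show "v = 0" using independent_at_combination_eq_0[OF assms] by blast
qed

text \<open>
  \<open>C_tilde C\<^sup>T\<close> is the identity and \<open>X\<^sub>j(x)\<close> is column
  \<open>j\<close> of \<open>C\<^sup>T\<close>.
\<close>

lemma C_tilde_inner_field:
  assumes "independent_at X x"
  shows "(g v* C_tilde X x) \<bullet> X j x = g $ j"
proof -
  let ?C = "coeff_matrix X x"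
  have "transpose ?C *v axis j 1 = X j x"
    using scaled_axis_mult_coeff_matrix[of 1 j X x] by simp
  then have "C_tilde X x *v X j x = matrix_inv (?C ** transpose ?C) ** (?C ** transpose ?C) *v axis j 1"
    by (metis C_tilde_def matrix_mul_assoc matrix_vector_mul_assoc)
  also have "\<dots> = axis j 1"
    using someI_ex[OF invertible_gram_matrix[OF assms, unfolded invertible_def]]
    by (simp add: matrix_inv_def)
  finally show ?thesis by (simp add: dot_lmul_matrix inner_axis)
qed

section \<open>The horizontal differential\<close>

text \<open>
  In a small ball \<open>B\<close> around \<open>x\<close> the horizontal derivatives
  \<open>g\<^sub>j - q \<bullet> X\<^sub>j\<close> of \<open>u - q \<bullet> z\<close> are at
  most \<open>\<eta>\<close>, and short curves from \<open>x\<close> stay in \<open>B\<close>.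
  The increment bound is applied to \<open>U - q \<bullet> z\<close> for a Friedrichs
  approximation \<open>U\<close> of accuracy \<open>\<tau>\<close>, and \<open>\<tau>\<close>
  tends to zero with the curve fixed.
\<close>

lemma subunit_curve_linear_approximation:
  fixes \<Omega> :: "(real^'n::finite) set" and X :: "'m::finite \<Rightarrow> real^'n \<Rightarrow> real^'n"
  assumes \<Omega>: "open \<Omega>" "x \<in> \<Omega>" and X: "\<And>j. Ck_on (Suc 0) \<Omega> (X j)"
    and u: "continuous_on \<Omega> u" and g: "continuous_hgrad \<Omega> X u g"
    and q: "\<And>j. q \<bullet> X j x = g x $ j" and \<epsilon>: "\<epsilon> > 0"
  obtains \<delta> where "\<delta> > 0" "\<And>T \<gamma>. \<lbrakk>0 \<le> T; T < \<delta>; subunit_curve \<Omega> X T \<gamma>; \<gamma> 0 = x\<rbrakk> \<Longrightarrow>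
    \<bar>u (\<gamma> T) - u x - q \<bullet> (\<gamma> T - x)\<bar> \<le> \<epsilon> * T"
proof -
  obtain a b where ab: "cbox a b \<subseteq> \<Omega>" "x \<in> box a b"
    using open_contains_cbox[OF \<Omega>] by metis
  define m where "m = real CARD('m)"
  have m: "m > 0" by (simp add: m_def)
  define \<eta> where "\<eta> = \<epsilon> / m"
  have \<eta>: "\<eta> > 0" "m * \<eta> = \<epsilon>" using \<epsilon> m by (auto simp: \<eta>_def)
  have Xc: "continuous_on (box a b) (X j)" and gc: "continuous_on (box a b) g" for j
    using Ck_on_imp_continuous_on[OF X] g ab(1) box_subset_cbox[of a b]
    unfolding continuous_hgrad_def by (meson continuous_on_subset order_trans)+
  define M where "M = (\<Sum>j\<in>UNIV. norm (X j x)) + 1"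
  define P where "P y \<longleftrightarrow> (\<forall>j. \<bar>g y $ j - q \<bullet> X j y\<bar> < \<eta> \<and> norm (X j y) < M)" for y
  have normX: "norm (X j x) < M" for j
    using member_le_sum[of j UNIV "\<lambda>j. norm (X j x)"] by (simp add: M_def)
  have "\<forall>\<^sub>F y in at x. \<bar>g y $ j - q \<bullet> X j y\<bar> < \<eta> \<and> norm (X j y) < M" for j
  proof (rule eventually_conj)
    have cont: "continuous (at x) (X j)" "continuous (at x) g"
      using Xc gc ab(2) continuous_on_eq_continuous_at[OF open_box] by blast+
    show "\<forall>\<^sub>F y in at x. norm (X j y) < M"
      by (rule order_tendstoD(2)[OF tendsto_norm[OF cont(1)[unfolded continuous_at]] normX])
    have "((\<lambda>y. \<bar>g y $ j - q \<bullet> X j y\<bar>) \<longlongrightarrow> \<bar>g x $ j - q \<bullet> X j x\<bar>) (at x)"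
      using cont unfolding continuous_at by (intro tendsto_intros)
    then show "\<forall>\<^sub>F y in at x. \<bar>g y $ j - q \<bullet> X j y\<bar> < \<eta>"
      by (rule order_tendstoD(2)) (simp add: q \<eta>(1))
  qed
  then have "\<forall>\<^sub>F y in at x. P y" unfolding P_def by (simp add: eventually_all_finite)
  moreover have "P x" by (simp add: P_def q \<eta>(1) normX)
  moreover have "\<forall>\<^sub>F y in nhds x. y \<in> box a b"
    using ab(2) by (intro eventually_nhds_in_open) auto
  ultimately have "\<forall>\<^sub>F y in nhds x. P y \<and> y \<in> box a b"
    by (simp add: eventually_conj_iff eventually_nhds_conv_at)
  then obtain r where r: "r > 0" "\<And>y. y \<in> cball x r \<Longrightarrow> P y \<and> y \<in> box a b"
    unfolding eventually_nhds_metric_le by (metis mem_cball dist_commute)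
  have M: "M \<ge> 1" by (simp add: M_def sum_nonneg)
  define \<delta> where "\<delta> = r / (m * M)"
  have \<delta>: "\<delta> > 0" using r(1) m M by (simp add: \<delta>_def)
  show ?thesis
  proof (rule that[OF \<delta>])
    fix T \<gamma> assume T: "0 \<le> T" "T < \<delta>" and \<gamma>: "subunit_curve \<Omega> X T \<gamma>" "\<gamma> 0 = x"
    have "m * M * T < r" using T m M by (simp add: \<delta>_def field_simps)
    then have inB: "\<gamma> ` {0..T} \<subseteq> cball x r"
      using subunit_curve_stays_in_cball[OF \<gamma>, of M r] T(1) M r(2) unfolding m_def P_def
      by (simp add: less_imp_le)
    have "\<gamma> T \<in> \<gamma> ` {0..T}" using T(1) by simp
    then have ends: "x \<in> cball x r" "\<gamma> T \<in> cball x r" using r(1) inB by (simp, blast)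
    have main: "\<bar>u (\<gamma> T) - u x - q \<bullet> (\<gamma> T - x)\<bar> \<le> m * (\<tau> + \<eta>) * T + 2 * \<tau>" if \<tau>: "\<tau> > 0" for \<tau>
    proof -
      have sub: "cball x r \<subseteq> box a b" using r(2) by blast
      obtain U G where U: "\<And>z. (U has_derivative (\<lambda>v. G z \<bullet> v)) (at z)" "continuous_on UNIV G"
        "\<And>z. z \<in> cball x r \<Longrightarrow> \<bar>U z - u z\<bar> \<le> \<tau>"
        "\<And>z j. z \<in> cball x r \<Longrightarrow> \<bar>G z \<bullet> X j z - g z $ j\<bar> \<le> \<tau>"
        using friedrichs_approximation[OF \<Omega>(1) ab(1) X u g compact_cball sub \<tau>] by blast
      define f where "f z = U z - q \<bullet> z" for z
      have fd: "(f has_derivative (\<lambda>v. (G z - q) \<bullet> v)) (at z)" for z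
        using has_derivative_diff[OF U(1) bounded_linear_imp_has_derivative[OF bounded_linear_inner_right]]
        unfolding f_def inner_diff_left .
      have "bounded ((\<lambda>z. G z - q) ` cball x r)"
        by (intro compact_imp_bounded compact_continuous_image continuous_on_diff continuous_on_const
            continuous_on_subset[OF U(2)]) auto
      then obtain C where C: "\<And>z. z \<in> cball x r \<Longrightarrow> norm (G z - q) \<le> C"
        unfolding bounded_iff by blast
      have "norm (f (\<gamma> T) - f (\<gamma> 0)) \<le> CARD('m) * (\<tau> + \<eta>) * T"
      proof (rule subunit_curve_increment_le[OF \<gamma>(1) T(1) order_refl convex_cball inB fd, where M = C])
        show "onorm (\<lambda>v. (G z - q) \<bullet> v) \<le> C" if "z \<in> cball x r" for z
        proof (rule onorm_le)
          fix v
          have "norm ((G z - q) \<bullet> v) \<le> norm (G z - q) * norm v" by (simp add: Cauchy_Schwarz_ineq2)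
          also have "\<dots> \<le> C * norm v" using C[OF that] by (rule mult_right_mono) simp
          finally show "norm ((G z - q) \<bullet> v) \<le> C * norm v" .
        qed
        show "norm ((G z - q) \<bullet> X j z) \<le> \<tau> + \<eta>" if z: "z \<in> cball x r" for z j
        proof -
          have "\<bar>g z $ j - q \<bullet> X j z\<bar> < \<eta>" using r(2)[OF z] unfolding P_def by blast
          then show ?thesis using U(4)[OF z, of j] by (simp add: inner_diff_left)
        qed
      qed (use \<tau> \<eta>(1) in simp)
      then have "\<bar>U (\<gamma> T) - U x - q \<bullet> (\<gamma> T - x)\<bar> \<le> m * (\<tau> + \<eta>) * T"
        by (simp add: f_def m_def \<gamma>(2) inner_diff_right algebra_simps)
      moreover have "\<bar>U (\<gamma> T) - u (\<gamma> T)\<bar> \<le> \<tau>" "\<bar>U x - u x\<bar> \<le> \<tau>" using U(3) ends by blast+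
      ultimately show ?thesis by linarith
    qed
    show "\<bar>u (\<gamma> T) - u x - q \<bullet> (\<gamma> T - x)\<bar> \<le> \<epsilon> * T"
    proof (rule field_le_epsilon)
      fix \<kappa> :: real assume \<kappa>: "\<kappa> > 0"
      define \<tau> where "\<tau> = \<kappa> / (m * T + 2)"
      have pos: "m * T + 2 > 0" using m T(1) by (simp add: add_nonneg_pos)
      then have \<tau>: "\<tau> > 0" "(m * T + 2) * \<tau> = \<kappa>" using \<kappa> by (auto simp: \<tau>_def)
      have "m * (\<tau> + \<eta>) * T + 2 * \<tau> = (m * \<eta>) * T + (m * T + 2) * \<tau>" by (simp add: algebra_simps)
      then show "\<bar>u (\<gamma> T) - u x - q \<bullet> (\<gamma> T - x)\<bar> \<le> \<epsilon> * T + \<kappa>"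
        using main[OF \<tau>(1)] \<tau>(2) \<eta>(2) by simp
    qed
  qed
qed

text \<open>
  An error of at most \<open>\<epsilon> T\<close> along every short curve from
  \<open>x\<close> to \<open>y\<close> gives an error of at most \<open>\<epsilon> d(x,
  y)\<close>, by taking curves whose duration approaches the infimum.
\<close>

lemma X_differentialI_subunit_curves:
  assumes "linear L"
    and approx: "\<And>\<epsilon>. \<epsilon> > 0 \<Longrightarrow> \<exists>\<delta>>0. \<forall>T \<gamma>. 0 \<le> T \<longrightarrow> T < \<delta> \<longrightarrow> subunit_curve \<Omega> X T \<gamma> \<longrightarrow> \<gamma> 0 = x \<longrightarrow>
      \<bar>u (\<gamma> T) - u x - L (\<gamma> T - x)\<bar> \<le> \<epsilon> * T"
  shows "X_differential \<Omega> X u x L"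
  unfolding X_differential_def
proof (intro conjI tendstoI)
  show "linear L" by fact
  fix \<epsilon> :: real assume \<epsilon>: "\<epsilon> > 0"
  then obtain \<delta> where \<delta>: "\<delta> > 0" "\<And>T \<gamma>. \<lbrakk>0 \<le> T; T < \<delta>; subunit_curve \<Omega> X T \<gamma>; \<gamma> 0 = x\<rbrakk> \<Longrightarrow>
      \<bar>u (\<gamma> T) - u x - L (\<gamma> T - x)\<bar> \<le> \<epsilon> / 2 * T"
    using approx[of "\<epsilon> / 2"] by (metis half_gt_zero)
  have bound: "dist ((u y - u x - L (y - x)) / enn2real (cc_dist \<Omega> X x y)) 0 < \<epsilon>"
    if y: "0 < cc_dist \<Omega> X x y" "cc_dist \<Omega> X x y < ennreal \<delta>" for y
  proof -
    define d where "d = enn2real (cc_dist \<Omega> X x y)"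
    have d_eq: "cc_dist \<Omega> X x y = ennreal d"
      using y(2) unfolding d_def by (metis ennreal_enn2real ennreal_less_top order.strict_trans)
    have d: "0 < d" "d < \<delta>" using y \<delta>(1) by (auto simp: d_eq ennreal_less_iff ennreal_less_zero_iff)
    let ?r = "\<bar>u y - u x - L (y - x)\<bar>"
    have "?r \<le> \<epsilon> / 2 * d"
    proof (rule ccontr)
      assume "\<not> ?thesis"
      then have "d < min \<delta> (?r / (\<epsilon> / 2))" using d \<epsilon> by (simp add: field_simps)
      then have "cc_dist \<Omega> X x y < ennreal (min \<delta> (?r / (\<epsilon> / 2)))"
        using d by (simp add: d_eq ennreal_less_iff)
      then obtain T \<gamma> where T: "T \<ge> 0" "ennreal T < ennreal (min \<delta> (?r / (\<epsilon> / 2)))"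
        and \<gamma>: "subunit_curve \<Omega> X T \<gamma>" "\<gamma> 0 = x" "\<gamma> T = y"
        unfolding cc_dist_def Inf_less_iff by blast
      then have T': "T < \<delta>" "T < ?r / (\<epsilon> / 2)" by (auto simp: ennreal_less_iff)
      have "?r \<le> \<epsilon> / 2 * T" using \<delta>(2)[OF T(1) T'(1) \<gamma>(1,2)] \<gamma>(3) by simp
      then show False using T'(2) \<epsilon> by (simp add: field_simps)
    qed
    then have "?r / d \<le> \<epsilon> / 2" using d by (simp add: field_simps)
    then have "?r / d < \<epsilon>" using \<epsilon> by linarith
    then show ?thesis using d(1) by (simp add: d_def[symmetric])
  qed
  have "\<forall>\<^sub>F d in at_right 0. 0 < d \<and> d < ennreal \<delta>"
    using \<delta>(1) by (subst eventually_at_right[of _ "ennreal \<delta>"]) (auto intro!: exI[of _ "ennreal \<delta>"])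
  then show "\<forall>\<^sub>F y in inf (filtercomap (cc_dist \<Omega> X x) (at_right 0)) (principal \<Omega>).
      dist ((u y - u x - L (y - x)) / enn2real (cc_dist \<Omega> X x y)) 0 < \<epsilon>"
    unfolding eventually_inf_principal eventually_filtercomap using bound by blast
qed

theorem proposition2p14:
  fixes \<Omega> :: "(real^'n::finite) set"
    and X :: "'m::finite \<Rightarrow> real^'n \<Rightarrow> real^'n"
    and u :: "real^'n \<Rightarrow> real"
    and Xu :: "real^'n \<Rightarrow> real^'m"
    and x :: "real^'n"
  assumes "CARD('m) \<le> CARD('n)"
    and "bounded_domain \<Omega>"
    and "\<And>j. smooth_on \<Omega> (X j)"
    and "hoermander \<Omega> X"
    and "\<And>y. y \<in> \<Omega> \<Longrightarrow> independent_at X y"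
    and "u \<in> C1X \<Omega> X"
    and "continuous_hgrad \<Omega> X u Xu"
    and "x \<in> \<Omega>"
  shows "X_differentiable \<Omega> X u x \<and>
    X_differential \<Omega> X u x (\<lambda>z. (Xu x v* C_tilde X x) \<bullet> z)"
proof -
  define q where "q = Xu x v* C_tilde X x"
  have \<Omega>: "open \<Omega>" using assms(2) by (simp add: bounded_domain_def)
  have X: "Ck_on (Suc 0) \<Omega> (X j)" for j using assms(3) by (auto simp: smooth_on_def)
  have u: "continuous_on \<Omega> u" using assms(6) by (simp add: C1X_def)
  have q: "q \<bullet> X j x = Xu x $ j" for j
    unfolding q_def by (rule C_tilde_inner_field[OF assms(5)[OF assms(8)]])
  have "X_differential \<Omega> X u x (\<lambda>z. q \<bullet> z)"
  proof (rule X_differentialI_subunit_curves)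
    show "linear (\<lambda>z. q \<bullet> z)" by (rule bounded_linear.linear[OF bounded_linear_inner_right])
    show "\<exists>\<delta>>0. \<forall>T \<gamma>. 0 \<le> T \<longrightarrow> T < \<delta> \<longrightarrow> subunit_curve \<Omega> X T \<gamma> \<longrightarrow> \<gamma> 0 = x \<longrightarrow>
      \<bar>u (\<gamma> T) - u x - q \<bullet> (\<gamma> T - x)\<bar> \<le> \<epsilon> * T" if "\<epsilon> > 0" for \<epsilon>
      using subunit_curve_linear_approximation[OF \<Omega> assms(8) X u assms(7) q that] by metis
  qed
  then show ?thesis
    unfolding X_differentiable_def q_def using u assms(8) by blast
qed

end
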